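(* The most general MacDowell–Mansouri (MDM) functional for the pair $(\mathrm{SU}(3),\mathrm{U}(2))$ in four dimensions, i.e. for a pair $(w,\Psi)$ of a $\mathrm{U}(2)$ connection $w$ and a $\mathrm{U}(2)$ frame $\Psi$, is, modulo topological terms, $$S[w,\Psi]=\int_M \Big(\lambda\,\Psi^\dagger\wedge F\wedge\Psi+\mu\, da\wedge(\Psi^\dagger\wedge\Psi)+\nu\,(\Psi^\dagger\wedge\Psi)\wedge(\Psi^\dagger\wedge\Psi)\Big),$$ with real parameters $\lambda,\mu,\nu$ satisfying $$3\lambda-\mu+4\nu=0 .$$ That is, for all real $p,q,r,s$ the functional $\int_M\mathrm{Tr}\big((pP+qQ)\,\mathcal F\wedge(rP+sQ)\,\mathcal F\big)$ equals, modulo topological terms, a functional of the displayed form with real $\lambda,\mu,\nu$ satisfying $3\lambda-\mu+4\nu=0$, and the functionals of the displayed form with real $\lambda,\mu,\nu$ subject to this relation are exactly the ones so obtained.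
   Context: $M$ is a smooth 4-manifold. $\Psi=\begin{pmatrix}\alpha\\ \beta\end{pmatrix}$ is a $\mathbb{C}^2$-valued 1-form on $M$ (the $\mathrm{U}(2)$ frame, in a local gauge), such that $\alpha,\beta,\bar\alpha,\bar\beta$ are pointwise linearly independent; $\Psi^\dagger=(\bar\alpha,\bar\beta)$. The $\mathrm{U}(2)$ connection is $w=A+\mathbb{I}\,a$, where $A$ is its traceless part (a $2\times2$ anti-Hermitian tracefree matrix of 1-forms, i.e. an $\mathrm{SU}(2)$ connection) and $a$ is an $\mathrm{i}\mathbb{R}$-valued 1-form (the $\mathrm{U}(1)$ part). $F=dA+A\wedge A$. Products of forms are wedge products. The Cartan connection is the $\mathfrak{su}(3)$-valued 1-form $$\mathcal A=\begin{pmatrix}A+\mathbb{I}a&\Psi\\-\Psi^\dagger&-2a\end{pmatrix},\qquad \mathcal F=d\mathcal A+\mathcal A\wedge\mathcal A ,$$ a $3\times3$ matrix of 2-forms in $2+1$ block form. Let $P=\mathrm{diag}(1,1,0)$ and $Q=\mathrm{diag}(0,0,1)$ be the projectors on the $2\times2$ and $1\times1$ diagonal blocks. The $(\mathrm{SU}(3),\mathrm{U}(2))$ MDM functionals are the $\mathrm{U}(2)$-invariant functionals $$S[\mathcal A]=\int_M\mathrm{Tr}\big(\Gamma_1\mathcal F\wedge\Gamma_2\mathcal F\big),\qquad \Gamma_1=pP+qQ,\ \Gamma_2=rP+sQ,\quad p,q,r,s\in\mathbb{R},$$ the trace being taken in the defining representation $\mathbb{C}^3$. "Modulo topological terms" means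 that one discards from the integrand constant multiples of $\mathrm{Tr}(F\wedge F)$ and $da\wedge da$, and exterior derivatives of $\mathrm{U}(2)$-invariant 3-forms built from $A,a,\Psi$. *)

theory Defs
  imports "HOL-Analysis.Analysis" "HOL-Library.Function_Algebras"
begin

section \<open>Smooth manifolds\<close>

text \<open>Only meaningful for open sets \<open>S\<close>, since derivatives are full derivatives at the points of \<open>S\<close>.\<close>

primrec C_k_on :: "nat \<Rightarrow> 'e::euclidean_space set \<Rightarrow> ('e \<Rightarrow> 'b::real_normed_vector) \<Rightarrow> bool" where
  "C_k_on 0 S f \<longleftrightarrow> continuous_on S f"
| "C_k_on (Suc k) S f \<longleftrightarrow>
     (\<forall>x\<in>S. f differentiable (at x)) \<and>
     (\<forall>v. C_k_on k S (\<lambda>x. frechet_derivative f (at x) v))"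

definition smooth_on :: "'e::euclidean_space set \<Rightarrow> ('e \<Rightarrow> 'b::real_normed_vector) \<Rightarrow> bool" where
  "smooth_on S f \<longleftrightarrow> (\<forall>k. C_k_on k S f)"

text \<open>The manifold is the whole type \<open>'m\<close>; a chart is a pair of its domain and its coordinate map
  (whose values outside the domain are irrelevant). Hausdorffness and second countability are
  imposed through the type classes of \<open>'m\<close>.\<close>

type_synonym ('m, 'e) atlas = "('m set \<times> ('m \<Rightarrow> 'e)) set"

definition smooth_atlas ::
  "('m::{t2_space, second_countable_topology}, 'e::euclidean_space) atlas \<Rightarrow> bool" where
  "smooth_atlas \<A> \<longleftrightarrow>
     (\<forall>(U, \<phi>)\<in>\<A>. open U \<and> open (\<phi> ` U) \<and> (\<exists>\<psi>. homeomorphism U (\<phi> ` U) \<phi> \<psi>)) \<and>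
     (\<Union>(U, \<phi>)\<in>\<A>. U) = UNIV \<and>
     (\<forall>(U, \<phi>)\<in>\<A>. \<forall>(V, \<psi>)\<in>\<A>. smooth_on (\<phi> ` (U \<inter> V)) (\<psi> \<circ> inv_into U \<phi>))"

definition smooth_fun :: "('m, 'e::euclidean_space) atlas \<Rightarrow> ('m \<Rightarrow> 'b::real_normed_vector) \<Rightarrow> bool" where
  "smooth_fun \<A> f \<longleftrightarrow> (\<forall>(U, \<phi>)\<in>\<A>. smooth_on (\<phi> ` U) (f \<circ> inv_into U \<phi>))"


section \<open>Vector fields\<close>

text \<open>A smooth vector field is a derivation of the algebra of smooth real functions. Its value on
  functions that are not smooth is fixed to be zero, so that two vector fields are equal as
  HOL functions iff they agree on smooth functions.\<close>

type_synonym 'm vfield = "('m \<Rightarrow> real) \<Rightarrow> 'm \<Rightarrow> real"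

definition vector_fields :: "('m, 'e::euclidean_space) atlas \<Rightarrow> 'm vfield set" where
  "vector_fields \<A> = {X.
     (\<forall>f. smooth_fun \<A> f \<longrightarrow> smooth_fun \<A> (X f)) \<and>
     (\<forall>f. \<not> smooth_fun \<A> f \<longrightarrow> X f = (\<lambda>_. 0)) \<and>
     (\<forall>f g. \<forall>b c :: real. smooth_fun \<A> f \<longrightarrow> smooth_fun \<A> g \<longrightarrow>
        X (\<lambda>x. b * f x + c * g x) = (\<lambda>x. b * X f x + c * X g x)) \<and>
     (\<forall>f g. smooth_fun \<A> f \<longrightarrow> smooth_fun \<A> g \<longrightarrow>
        X (\<lambda>x. f x * g x) = (\<lambda>x. f x * X g x + X f x * g x))}"

definition lie_bracket :: "'m vfield \<Rightarrow> 'm vfield \<Rightarrow> 'm vfield" where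
  "lie_bracket X Y = (\<lambda>f x. X (Y f) x - Y (X f) x)"

definition derive_complex :: "'m vfield \<Rightarrow> ('m \<Rightarrow> complex) \<Rightarrow> 'm \<Rightarrow> complex" where
  "derive_complex X f = (\<lambda>x. Complex (X (\<lambda>y. Re (f y)) x) (X (\<lambda>y. Im (f y)) x))"


section \<open>Complex-valued differential forms\<close>

text \<open>A \<open>k\<close>-form is a map on vector fields that is multilinear over the smooth real functions and
  alternating. Forms of all degrees live in one type: a \<open>k\<close>-form is evaluated on a list of
  vector fields and vanishes on lists that are not lists of \<open>k\<close> vector fields. In particular
  equality of \<open>k\<close>-forms is equality in HOL. Sums of forms are pointwise. The pointwise product
  that comes with the function type is \<^emph>\<open>not\<close> the product of forms; the latter is
  \<open>\<^bold>\<and>\<close> below.\<close>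

type_synonym 'm form = "'m vfield list \<Rightarrow> 'm \<Rightarrow> complex"

definition is_form :: "('m, 'e::euclidean_space) atlas \<Rightarrow> nat \<Rightarrow> 'm form \<Rightarrow> bool" where
  "is_form \<A> k \<omega> \<longleftrightarrow>
     (\<forall>Xs. \<not> (length Xs = k \<and> set Xs \<subseteq> vector_fields \<A>) \<longrightarrow> \<omega> Xs = (\<lambda>_. 0)) \<and>
     (\<forall>Xs. length Xs = k \<longrightarrow> set Xs \<subseteq> vector_fields \<A> \<longrightarrow>
        smooth_fun \<A> (\<omega> Xs) \<and>
        (\<forall>i<k. \<forall>Y\<in>vector_fields \<A>. \<forall>Z\<in>vector_fields \<A>. \<forall>f g.
           smooth_fun \<A> f \<longrightarrow> smooth_fun \<A> g \<longrightarrow>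
           \<omega> (Xs[i := (\<lambda>h x. f x * Y h x + g x * Z h x)]) =
             (\<lambda>x. complex_of_real (f x) * \<omega> (Xs[i := Y]) x
                + complex_of_real (g x) * \<omega> (Xs[i := Z]) x)) \<and>
        (\<forall>i<k. \<forall>j<k. i \<noteq> j \<longrightarrow> Xs ! i = Xs ! j \<longrightarrow> \<omega> Xs = (\<lambda>_. 0)))"

definition zero_form :: "('m \<Rightarrow> complex) \<Rightarrow> 'm form" where
  "zero_form f = (\<lambda>Xs. if Xs = [] then f else (\<lambda>_. 0))"

definition scale_form :: "complex \<Rightarrow> 'm form \<Rightarrow> 'm form" where
  "scale_form c \<omega> = (\<lambda>Xs x. c * \<omega> Xs x)"

definition conj_form :: "'m form \<Rightarrow> 'm form" where
  "conj_form \<omega> = (\<lambda>Xs x. cnj (\<omega> Xs x))"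

text \<open>The wedge product as a signed sum over shuffles:
  $(\omega\wedge\eta)(X_1,\dots,X_n)=\sum_S\pm\,\omega(X_S)\,\eta(X_{S^c})$, where $S$ runs over the
  sets of positions handed to $\omega$, and the sign is that of the permutation listing first
  $S$ and then $S^c$ in increasing order. If $\omega$ is a $k$-form, only the sets $S$ with $k$
  elements contribute, so that $(\alpha\wedge\beta)(X,Y)=\alpha(X)\beta(Y)-\alpha(Y)\beta(X)$ for
  1-forms.\<close>

definition shuffle_sign :: "nat \<Rightarrow> nat set \<Rightarrow> complex" where
  "shuffle_sign n S = (-1) ^ card {(i, j). i \<in> S \<and> j \<in> {..<n} - S \<and> j < i}"

definition wedge :: "'m form \<Rightarrow> 'm form \<Rightarrow> 'm form" (infixl \<open>\<^bold>\<and>\<close> 70) where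
  "\<omega> \<^bold>\<and> \<eta> = (\<lambda>Xs x. \<Sum>S\<in>Pow {..<length Xs}.
      shuffle_sign (length Xs) S * \<omega> (nths Xs S) x * \<eta> (nths Xs (- S)) x)"

text \<open>The exterior derivative, by the coordinate-free (Koszul) formula
  $$d\omega(X_0,\dots,X_k)=\sum_i(-1)^iX_i\,\omega(\dots\widehat{X_i}\dots)
    +\sum_{i<j}(-1)^{i+j}\omega([X_i,X_j],\dots\widehat{X_i}\dots\widehat{X_j}\dots).$$\<close>

definition ext_d :: "('m, 'e::euclidean_space) atlas \<Rightarrow> 'm form \<Rightarrow> 'm form" where
  "ext_d \<A> \<omega> = (\<lambda>Xs x. if set Xs \<subseteq> vector_fields \<A> then
      (\<Sum>i<length Xs. (-1) ^ i * derive_complex (Xs ! i) (\<omega> (nths Xs (- {i}))) x)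
      + (\<Sum>(i, j)\<in>{(i, j). i < j \<and> j < length Xs}.
           (-1) ^ (i + j) * \<omega> (lie_bracket (Xs ! i) (Xs ! j) # nths Xs (- {i, j})) x)
    else 0)"


section \<open>Matrices of forms\<close>

definition mwedge :: "'m form^'n^'l \<Rightarrow> 'm form^'k^'n \<Rightarrow> 'm form^'k^'l" (infixl \<open>\<^bold>\<and>\<^sub>m\<close> 70) where
  "M \<^bold>\<and>\<^sub>m N = (\<chi> i j. \<Sum>k\<in>UNIV. M $ i $ k \<^bold>\<and> N $ k $ j)"

definition mext_d :: "('m, 'e::euclidean_space) atlas \<Rightarrow> 'm form^'k^'l \<Rightarrow> 'm form^'k^'l" where
  "mext_d \<A> M = (\<chi> i j. ext_d \<A> (M $ i $ j))"

definition mscale :: "complex^'n^'l \<Rightarrow> 'm form^'k^'n \<Rightarrow> 'm form^'k^'l" where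
  "mscale G M = (\<chi> i j. \<Sum>k\<in>UNIV. scale_form (G $ i $ k) (M $ k $ j))"

definition curvature :: "('m, 'e::euclidean_space) atlas \<Rightarrow> 'm form^'n^'n \<Rightarrow> 'm form^'n^'n" where
  "curvature \<A> W = mext_d \<A> W + W \<^bold>\<and>\<^sub>m W"


section \<open>Field configurations\<close>

definition is_frame :: "('m, 'e::euclidean_space) atlas \<Rightarrow> 'm form^2 \<Rightarrow> bool" where
  "is_frame \<A> \<Psi> \<longleftrightarrow>
     (\<forall>i. is_form \<A> 1 (\<Psi> $ i)) \<and>
     (\<forall>x. \<forall>c1 c2 c3 c4 :: complex.
        (\<forall>X\<in>vector_fields \<A>.
           c1 * (\<Psi> $ 1) [X] x + c2 * (\<Psi> $ 2) [X] x
           + c3 * conj_form (\<Psi> $ 1) [X] x + c4 * conj_form (\<Psi> $ 2) [X] x = 0) \<longrightarrow>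
        c1 = 0 \<and> c2 = 0 \<and> c3 = 0 \<and> c4 = 0)"

definition is_su2_connection :: "('m, 'e::euclidean_space) atlas \<Rightarrow> 'm form^2^2 \<Rightarrow> bool" where
  "is_su2_connection \<A> A \<longleftrightarrow>
     (\<forall>i j. is_form \<A> 1 (A $ i $ j)) \<and>
     (\<forall>i j. conj_form (A $ j $ i) = - (A $ i $ j)) \<and>
     trace A = 0"

definition is_u1_connection :: "('m, 'e::euclidean_space) atlas \<Rightarrow> 'm form \<Rightarrow> bool" where
  "is_u1_connection \<A> a \<longleftrightarrow> is_form \<A> 1 a \<and> conj_form a = - a"

definition field_config ::
  "('m, 'e::euclidean_space) atlas \<Rightarrow> 'm form^2^2 \<Rightarrow> 'm form \<Rightarrow> 'm form^2 \<Rightarrow> bool" where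
  "field_config \<A> A a \<Psi> \<longleftrightarrow>
     is_su2_connection \<A> A \<and> is_u1_connection \<A> a \<and> is_frame \<A> \<Psi>"

definition cartan_connection :: "'m form^2^2 \<Rightarrow> 'm form \<Rightarrow> 'm form^2 \<Rightarrow> 'm form^3^3" where
  "cartan_connection A a \<Psi> = vector [
     vector [A $ 1 $ 1 + a,        A $ 1 $ 2,            \<Psi> $ 1],
     vector [A $ 2 $ 1,            A $ 2 $ 2 + a,        \<Psi> $ 2],
     vector [- conj_form (\<Psi> $ 1), - conj_form (\<Psi> $ 2), scale_form (-2) a]]"


section \<open>Gauge transformations\<close>

text \<open>The group $\mathrm{U}(2)$ sits in $\mathrm{SU}(3)$ as the block diagonal subgroup of the
  matrices $\mathrm{diag}(U,\det U^{-1})$.\<close>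

definition U2_subgroup :: "(complex^3^3) set" where
  "U2_subgroup = {h. h ** (\<chi> i j. cnj (h $ j $ i)) = mat 1 \<and> det h = 1 \<and>
     h $ 1 $ 3 = 0 \<and> h $ 2 $ 3 = 0 \<and> h $ 3 $ 1 = 0 \<and> h $ 3 $ 2 = 0}"

definition is_gauge_map :: "('m, 'e::euclidean_space) atlas \<Rightarrow> ('m \<Rightarrow> complex^3^3) \<Rightarrow> bool" where
  "is_gauge_map \<A> h \<longleftrightarrow> smooth_fun \<A> h \<and> (\<forall>x. h x \<in> U2_subgroup)"

text \<open>The transformation $\mathcal A\mapsto h\mathcal Ah^{-1}+h\,dh^{-1}$ with
  $h^{-1}=h^\dagger$.\<close>

definition gauge_transform ::
  "('m, 'e::euclidean_space) atlas \<Rightarrow> ('m \<Rightarrow> complex^3^3) \<Rightarrow> 'm form^3^3 \<Rightarrow> 'm form^3^3" where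
  "gauge_transform \<A> h W =
     (let H = (\<chi> i j. zero_form (\<lambda>x. h x $ i $ j));
          K = (\<chi> i j. zero_form (\<lambda>x. cnj (h x $ j $ i)))
      in H \<^bold>\<and>\<^sub>m W \<^bold>\<and>\<^sub>m K + H \<^bold>\<and>\<^sub>m mext_d \<A> K)"


section \<open>Equality modulo topological terms\<close>

text \<open>A functional \<open>S = \<integral>\<^sub>M L\<close> of the fields is given by its integrand \<open>L\<close>, and equality of
  functionals modulo topological terms is a relation between the integrands (no compactness
  of the manifold is assumed, so the integrals themselves need not converge).\<close>

type_synonym 'm integrand = "'m form^2^2 \<Rightarrow> 'm form \<Rightarrow> 'm form^2 \<Rightarrow> 'm form"

text \<open>The expressions built from \<open>A\<close>, \<open>a\<close>, \<open>\<Psi>\<close>: those obtained from the components of the fields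
  by complex linear combinations, wedge products, exterior derivatives and complex conjugation.
  They have to be the same expressions for all fields: without such a
  restriction every 4-form that happens to be exact would count as topological.\<close>

inductive_set built_from_fields :: "('m, 'e::euclidean_space) atlas \<Rightarrow> 'm integrand set"
  for \<A> :: "('m, 'e) atlas" where
  su2: "(\<lambda>A a \<Psi>. A $ i $ j) \<in> built_from_fields \<A>"
| u1: "(\<lambda>A a \<Psi>. a) \<in> built_from_fields \<A>"
| frame: "(\<lambda>A a \<Psi>. \<Psi> $ i) \<in> built_from_fields \<A>"
| conj: "\<theta> \<in> built_from_fields \<A> \<Longrightarrow>
    (\<lambda>A a \<Psi>. conj_form (\<theta> A a \<Psi>)) \<in> built_from_fields \<A>"
| scale: "\<theta> \<in> built_from_fields \<A> \<Longrightarrow>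
    (\<lambda>A a \<Psi>. scale_form c (\<theta> A a \<Psi>)) \<in> built_from_fields \<A>"
| add: "\<theta> \<in> built_from_fields \<A> \<Longrightarrow> \<eta> \<in> built_from_fields \<A> \<Longrightarrow>
    (\<lambda>A a \<Psi>. \<theta> A a \<Psi> + \<eta> A a \<Psi>) \<in> built_from_fields \<A>"
| wedge: "\<theta> \<in> built_from_fields \<A> \<Longrightarrow> \<eta> \<in> built_from_fields \<A> \<Longrightarrow>
    (\<lambda>A a \<Psi>. \<theta> A a \<Psi> \<^bold>\<and> \<eta> A a \<Psi>) \<in> built_from_fields \<A>"
| ext_d: "\<theta> \<in> built_from_fields \<A> \<Longrightarrow>
    (\<lambda>A a \<Psi>. ext_d \<A> (\<theta> A a \<Psi>)) \<in> built_from_fields \<A>"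

definition U2_invariant :: "('m, 'e::euclidean_space) atlas \<Rightarrow> 'm integrand \<Rightarrow> bool" where
  "U2_invariant \<A> \<theta> \<longleftrightarrow>
     (\<forall>h A a \<Psi> A' a' \<Psi>'.
        is_gauge_map \<A> h \<longrightarrow> field_config \<A> A a \<Psi> \<longrightarrow> field_config \<A> A' a' \<Psi>' \<longrightarrow>
        cartan_connection A' a' \<Psi>' = gauge_transform \<A> h (cartan_connection A a \<Psi>) \<longrightarrow>
        \<theta> A' a' \<Psi>' = \<theta> A a \<Psi>)"

definition invariant_3_forms :: "('m, 'e::euclidean_space) atlas \<Rightarrow> 'm integrand set" where
  "invariant_3_forms \<A> = {\<theta> \<in> built_from_fields \<A>. U2_invariant \<A> \<theta> \<and>
     (\<forall>A a \<Psi>. field_config \<A> A a \<Psi> \<longrightarrow> is_form \<A> 3 (\<theta> A a \<Psi>))}"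

definition equal_mod_topological ::
  "('m, 'e::euclidean_space) atlas \<Rightarrow> 'm integrand \<Rightarrow> 'm integrand \<Rightarrow> bool" where
  "equal_mod_topological \<A> L L' \<longleftrightarrow>
     (\<exists>c1 c2 :: real. \<exists>\<theta>\<in>invariant_3_forms \<A>. \<forall>A a \<Psi>. field_config \<A> A a \<Psi> \<longrightarrow>
        L A a \<Psi> = L' A a \<Psi>
          + scale_form (complex_of_real c1) (trace (curvature \<A> A \<^bold>\<and>\<^sub>m curvature \<A> A))
          + scale_form (complex_of_real c2) (ext_d \<A> a \<^bold>\<and> ext_d \<A> a)
          + ext_d \<A> (\<theta> A a \<Psi>))"


section \<open>The functionals\<close>

definition P_proj :: "complex^3^3" where
  "P_proj = vector [vector [1, 0, 0], vector [0, 1, 0], vector [0, 0, 0]]"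

definition Q_proj :: "complex^3^3" where
  "Q_proj = vector [vector [0, 0, 0], vector [0, 0, 0], vector [0, 0, 1]]"

definition MDM_integrand ::
  "('m, 'e::euclidean_space) atlas \<Rightarrow> real \<Rightarrow> real \<Rightarrow> real \<Rightarrow> real \<Rightarrow> 'm integrand" where
  "MDM_integrand \<A> p q r s = (\<lambda>A a \<Psi>.
     let \<F> = curvature \<A> (cartan_connection A a \<Psi>);
         \<Gamma>1 = p *\<^sub>R P_proj + q *\<^sub>R Q_proj;
         \<Gamma>2 = r *\<^sub>R P_proj + s *\<^sub>R Q_proj
     in trace (mscale \<Gamma>1 \<F> \<^bold>\<and>\<^sub>m mscale \<Gamma>2 \<F>))"

definition dagger_psi :: "'m form^2 \<Rightarrow> 'm form" where
  "dagger_psi \<Psi> = (\<Sum>i\<in>UNIV. conj_form (\<Psi> $ i) \<^bold>\<and> \<Psi> $ i)"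

definition dagger_F_psi :: "'m form^2 \<Rightarrow> 'm form^2^2 \<Rightarrow> 'm form" where
  "dagger_F_psi \<Psi> F = (\<Sum>i\<in>UNIV. \<Sum>j\<in>UNIV. conj_form (\<Psi> $ i) \<^bold>\<and> F $ i $ j \<^bold>\<and> \<Psi> $ j)"

definition frame_integrand ::
  "('m, 'e::euclidean_space) atlas \<Rightarrow> real \<Rightarrow> real \<Rightarrow> real \<Rightarrow> 'm integrand" where
  "frame_integrand \<A> lam mu nu = (\<lambda>A a \<Psi>.
     scale_form (complex_of_real lam) (dagger_F_psi \<Psi> (curvature \<A> A))
     + scale_form (complex_of_real mu) (ext_d \<A> a \<^bold>\<and> dagger_psi \<Psi>)
     + scale_form (complex_of_real nu) (dagger_psi \<Psi> \<^bold>\<and> dagger_psi \<Psi>))"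

end

theory Submission
  imports Defs
begin

text \<open>Write $T=ps+qr$. The diagonal blocks of $\mathcal F$ are
  $F+\mathbb I\,da-\Psi\wedge\Psi^\dagger$ and $-2da-\Psi^\dagger\wedge\Psi$, and the off-diagonal
  ones are $D\Psi=d\Psi+A\wedge\Psi+3a\wedge\Psi$ and $-(D\Psi)^\dagger$. Expanding the trace, the two
  diagonal blocks contribute with coefficients $pr$ and $qs$ to the three terms of the frame
  functional and to the topological densities. The off-diagonal blocks contribute
  $-T\,(D\Psi)^\dagger\wedge D\Psi$, which by $D^2\Psi=(F+3da)\wedge\Psi$ is
  $-T\,(\Psi^\dagger\wedge F\wedge\Psi+3\,da\wedge(\Psi^\dagger\wedge\Psi))$ up to the differential of the
  invariant 3-form $-T\,\Psi^\dagger\wedge D\Psi$. So $\lambda=2pr-T$, $\mu=2pr+4qs-3T$ and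
  $\nu=qs-pr$. This is the whole solution space of $3\lambda-\mu+4\nu=0$: it is already
  exhausted by $p=0$, $q=1$, $r=-\lambda$, $s=\nu$.

  Invariance of the 3-form follows from that of the curvature: $\Psi^\dagger\wedge D\Psi$ is minus the trace of
  the product of the lower left block of $\mathcal A$ with the upper right block of $\mathcal F$, and
  the inhomogeneous term $h\,dh^{-1}$ of a gauge transformation is block diagonal.\<close>

section \<open>Smooth functions\<close>

text \<open>The parameters depend linearly on three products: (\<lambda>, \<mu>, \<nu>) = pr (2, 2,
  -1) + qs (0, 4, 1) + T (-1, -3, 0), and each of the three vectors satisfies the relation. The
  products themselves are not free, because T^2 - 4 pr qs = (ps - qr)^2 is nonnegative; setting p =
  0 removes this constraint, and the vectors belonging to qs and T already span the plane. The two
  off-diagonal contributions enter only through T because 2-forms commute. The sign of pr in \<nu>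
  comes from moving a 1-form cyclically past a 3-form: the trace of the square of \<Psi> \<and>
  \<Psi>\<dagger> is minus the square of \<Psi>\<dagger> \<and> \<Psi>. Forms are functions on lists
  of vector fields, so the exterior calculus has to be derived from the Koszul formula and the
  shuffle sum. Associativity and graded commutativity are proved in all degrees, by recursion on the
  arguments. Facts about d that need multilinearity are proved by explicit evaluation, since only
  the products 1 \<and> 1 and 1 \<and> 2 are ever differentiated.\<close>

lemma C_k_on_cong:
  assumes "open S" "\<And>x. x \<in> S \<Longrightarrow> f x = g x" "C_k_on k S f"
  shows "C_k_on k S g"
  using assms(2,3)
proof (induction k arbitrary: f g)
  case 0
  then show ?case by (simp cong: continuous_on_cong)
next
  case (Suc k)
  \<comment> \<open>The derivative at x sees only the germ of the function, and S is a neighbourhood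
    of x. The rules below need this, since they compute the derivative of a sum or product only at
    points of S.\<close>
  have deriv: "(f has_derivative D) (at x) \<longleftrightarrow> (g has_derivative D) (at x)" if "x \<in> S" for x D
    using has_derivative_transform_within_open[of f D x UNIV S g]
      has_derivative_transform_within_open[of g D x UNIV S f] assms(1) that Suc.prems(1)
    by (metis)
  then have "frechet_derivative f (at x) = frechet_derivative g (at x)" if "x \<in> S" for x
    using that by (simp add: frechet_derivative_def)
  then have "C_k_on k S (\<lambda>x. frechet_derivative g (at x) v)" for v
    using Suc.IH[of "\<lambda>x. frechet_derivative f (at x) v"] Suc.prems(2) by simp
  moreover have "g differentiable (at x)" if "x \<in> S" for x
    using Suc.prems(2) that deriv by (auto simp: differentiable_def)
  ultimately show ?case by simp
qed

lemma C_k_on_Suc_imp: "C_k_on (Suc k) S f \<Longrightarrow> C_k_on k S f"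
proof (induction k arbitrary: f)
  case 0
  then show ?case
    by (simp add: differentiable_imp_continuous_on differentiable_at_imp_differentiable_on)
next
  case (Suc k)
  then show ?case by (metis C_k_on.simps(2))
qed

lemma C_k_on_has_derivative:
  "C_k_on (Suc k) S f \<Longrightarrow> x \<in> S \<Longrightarrow> (f has_derivative frechet_derivative f (at x)) (at x)"
  using frechet_derivative_works[of f "at x"] by simp

lemma C_k_on_const: "C_k_on k S (\<lambda>_. c)"
  by (induction k arbitrary: c) (auto simp: frechet_derivative_const)

text \<open>A single induction for an arbitrary bounded linear map covers conjugation, real and
  imaginary parts, negation, vector components and the embedding of the reals.\<close>

lemma C_k_on_linear:
  assumes "open S" "bounded_linear L" "C_k_on k S f"
  shows "C_k_on k S (\<lambda>x. L (f x))"
  using assms(3)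
proof (induction k arbitrary: f)
  case 0
  then show ?case by (simp add: bounded_linear.continuous_on[OF assms(2)])
next
  case (Suc k)
  have deriv: "((\<lambda>x. L (f x)) has_derivative (\<lambda>v. L (frechet_derivative f (at x) v))) (at x)"
    if "x \<in> S" for x
    by (rule bounded_linear.has_derivative[OF assms(2) C_k_on_has_derivative[OF Suc.prems that]])
  have "C_k_on k S (\<lambda>x. L (frechet_derivative f (at x) v))" for v
    using Suc by simp
  then have "C_k_on k S (\<lambda>x. frechet_derivative (\<lambda>x. L (f x)) (at x) v)" for v
    by (rule C_k_on_cong[OF assms(1), rotated]) (simp add: frechet_derivative_at[OF deriv, symmetric])
  then show ?case using deriv by (auto simp: differentiable_def)
qed

lemma C_k_on_add:
  assumes "open S" "C_k_on k S f" "C_k_on k S g"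
  shows "C_k_on k S (\<lambda>x. f x + g x)"
  using assms(2,3)
proof (induction k arbitrary: f g)
  case 0
  then show ?case by (simp add: continuous_on_add)
next
  case (Suc k)
  have deriv: "((\<lambda>x. f x + g x) has_derivative
      (\<lambda>v. frechet_derivative f (at x) v + frechet_derivative g (at x) v)) (at x)"
    if "x \<in> S" for x
    by (rule has_derivative_add[OF Suc.prems[THEN C_k_on_has_derivative, OF that]])
  have "C_k_on k S (\<lambda>x. frechet_derivative f (at x) v + frechet_derivative g (at x) v)" for v
    using Suc by simp
  then have "C_k_on k S (\<lambda>x. frechet_derivative (\<lambda>x. f x + g x) (at x) v)" for v
    by (rule C_k_on_cong[OF assms(1), rotated]) (simp add: frechet_derivative_at[OF deriv, symmetric])
  then show ?case using deriv by (auto simp: differentiable_def)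
qed

text \<open>The product rule gives two terms of the same shape, B(f, g') and B(f', g), so the
  induction generalises over both functions.\<close>

lemma C_k_on_bilinear:
  assumes "open S" "bounded_bilinear B" "C_k_on k S f" "C_k_on k S g"
  shows "C_k_on k S (\<lambda>x. B (f x) (g x))"
  using assms(3,4)
proof (induction k arbitrary: f g)
  case 0
  then show ?case by (simp add: bounded_bilinear.continuous_on[OF assms(2)])
next
  case (Suc k)
  have deriv: "((\<lambda>x. B (f x) (g x)) has_derivative
      (\<lambda>v. B (f x) (frechet_derivative g (at x) v) + B (frechet_derivative f (at x) v) (g x))) (at x)"
    if "x \<in> S" for x
    by (rule bounded_bilinear.FDERIV[OF assms(2) Suc.prems[THEN C_k_on_has_derivative, OF that]])
  have "C_k_on k S (\<lambda>x. B (f x) (frechet_derivative g (at x) v) +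
      B (frechet_derivative f (at x) v) (g x))" for v
    \<comment> \<open>One factor of each term is not differentiated; its order is lowered from
      \<open>Suc k\<close> to \<open>k\<close>.\<close>
    using Suc.prems C_k_on_Suc_imp[OF Suc.prems(1)] C_k_on_Suc_imp[OF Suc.prems(2)]
    by (intro C_k_on_add assms(1) Suc.IH) simp_all
  then have "C_k_on k S (\<lambda>x. frechet_derivative (\<lambda>x. B (f x) (g x)) (at x) v)" for v
    by (rule C_k_on_cong[OF assms(1), rotated]) (simp add: frechet_derivative_at[OF deriv, symmetric])
  then show ?case using deriv by (auto simp: differentiable_def)
qed

section \<open>Smooth functions on the manifold, chart by chart\<close>

lemma smooth_fun_alt:
  "smooth_fun \<A> f \<longleftrightarrow> (\<forall>(U, \<phi>)\<in>\<A>. \<forall>k. C_k_on k (\<phi> ` U) (\<lambda>y. f (inv_into U \<phi> y)))"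
  by (simp add: smooth_fun_def smooth_on_def comp_def)

lemma smooth_atlas_open_image: "smooth_atlas \<A> \<Longrightarrow> (U, \<phi>) \<in> \<A> \<Longrightarrow> open (\<phi> ` U)"
  by (auto simp: smooth_atlas_def)

lemma smooth_fun_const [simp]: "smooth_fun \<A> (\<lambda>_. c)"
  by (simp add: smooth_fun_alt C_k_on_const)

lemma smooth_fun_linear:
  assumes "smooth_atlas \<A>" "bounded_linear L" "smooth_fun \<A> f"
  shows "smooth_fun \<A> (\<lambda>x. L (f x))"
  using assms(3) C_k_on_linear[OF smooth_atlas_open_image[OF assms(1)] assms(2)]
  unfolding smooth_fun_alt by blast

lemma smooth_fun_bilinear:
  assumes "smooth_atlas \<A>" "bounded_bilinear B" "smooth_fun \<A> f" "smooth_fun \<A> g"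
  shows "smooth_fun \<A> (\<lambda>x. B (f x) (g x))"
  using assms(3,4) C_k_on_bilinear[OF smooth_atlas_open_image[OF assms(1)] assms(2)]
  unfolding smooth_fun_alt by blast

lemma smooth_fun_add:
  assumes "smooth_atlas \<A>" "smooth_fun \<A> f" "smooth_fun \<A> g"
  shows "smooth_fun \<A> (\<lambda>x. f x + g x)"
  using assms(2,3) C_k_on_add[OF smooth_atlas_open_image[OF assms(1)]]
  unfolding smooth_fun_alt by blast

lemma smooth_fun_mult:
  fixes f g :: "_ \<Rightarrow> _ :: real_normed_algebra"
  assumes "smooth_atlas \<A>" "smooth_fun \<A> f" "smooth_fun \<A> g"
  shows "smooth_fun \<A> (\<lambda>x. f x * g x)"
  using smooth_fun_bilinear[OF assms(1) bounded_bilinear_mult assms(2,3)] .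

lemma smooth_fun_minus:
  assumes "smooth_atlas \<A>" "smooth_fun \<A> f"
  shows "smooth_fun \<A> (\<lambda>x. - f x)"
  using smooth_fun_linear[OF assms(1) bounded_linear_minus[OF bounded_linear_ident] assms(2)] .

lemma smooth_fun_diff:
  assumes "smooth_atlas \<A>" "smooth_fun \<A> f" "smooth_fun \<A> g"
  shows "smooth_fun \<A> (\<lambda>x. f x - g x)"
  using smooth_fun_add[OF assms(1,2) smooth_fun_minus[OF assms(1,3)]] by simp

lemma smooth_fun_of_real:
  assumes "smooth_atlas \<A>" "smooth_fun \<A> f"
  shows "smooth_fun \<A> (\<lambda>x. complex_of_real (f x))"
  using smooth_fun_linear[OF assms(1) bounded_linear_of_real assms(2)] .

lemma smooth_fun_cnj:
  assumes "smooth_atlas \<A>" "smooth_fun \<A> f"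
  shows "smooth_fun \<A> (\<lambda>x. cnj (f x))"
  using smooth_fun_linear[OF assms(1) bounded_linear_cnj assms(2)] .

lemma smooth_fun_Re:
  assumes "smooth_atlas \<A>" "smooth_fun \<A> f"
  shows "smooth_fun \<A> (\<lambda>x. Re (f x))"
  using smooth_fun_linear[OF assms(1) bounded_linear_Re assms(2)] .

lemma smooth_fun_Im:
  assumes "smooth_atlas \<A>" "smooth_fun \<A> f"
  shows "smooth_fun \<A> (\<lambda>x. Im (f x))"
  using smooth_fun_linear[OF assms(1) bounded_linear_Im assms(2)] .

lemma smooth_fun_Complex:
  assumes "smooth_atlas \<A>" "smooth_fun \<A> f" "smooth_fun \<A> g"
  shows "smooth_fun \<A> (\<lambda>x. Complex (f x) (g x))"
proof -
  have "smooth_fun \<A> (\<lambda>x. complex_of_real (f x) + \<i> * complex_of_real (g x))"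
    by (intro smooth_fun_add smooth_fun_mult smooth_fun_of_real smooth_fun_const assms)
  then show ?thesis by (simp add: Complex_eq)
qed

lemma smooth_fun_sum:
  assumes "smooth_atlas \<A>" "\<And>i. i \<in> I \<Longrightarrow> smooth_fun \<A> (f i)"
  shows "smooth_fun \<A> (\<lambda>x. \<Sum>i\<in>I. f i x)"
  using assms(2) by (induction I rule: infinite_finite_induct) (simp_all add: smooth_fun_add assms(1))

lemma smooth_fun_nth:
  assumes "smooth_atlas \<A>" "smooth_fun \<A> f"
  shows "smooth_fun \<A> (\<lambda>x. f x $ i)"
  using smooth_fun_linear[OF assms(1) bounded_linear_vec_nth assms(2)] .


section \<open>Vector fields\<close>

lemma
  assumes "X \<in> vector_fields \<A>"
  shows vector_field_smooth: "smooth_fun \<A> f \<Longrightarrow> smooth_fun \<A> (X f)"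
    and vector_field_nonsmooth: "\<not> smooth_fun \<A> f \<Longrightarrow> X f = (\<lambda>_. 0)"
    and vector_field_linear: "smooth_fun \<A> f \<Longrightarrow> smooth_fun \<A> g \<Longrightarrow>
        X (\<lambda>x. b * f x + c * g x) = (\<lambda>x. b * X f x + c * X g x)"
    and vector_field_mult: "smooth_fun \<A> f \<Longrightarrow> smooth_fun \<A> g \<Longrightarrow>
        X (\<lambda>x. f x * g x) = (\<lambda>x. f x * X g x + X f x * g x)"
  using assms by (auto simp: vector_fields_def)

text \<open>The Leibniz rule on 1 = 1 * 1 gives X 1 = 2 X 1, hence X 1 = 0; linearity does the
  rest.\<close>

lemma vector_field_const:
  assumes "X \<in> vector_fields \<A>"
  shows "X (\<lambda>_. c) = (\<lambda>_. 0)"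
proof -
  have "X (\<lambda>_. 1) = (\<lambda>_. 0)"
    using vector_field_mult[OF assms, of "\<lambda>_. 1" "\<lambda>_. 1"] by (auto simp: fun_eq_iff)
  then show ?thesis
    using vector_field_linear[OF assms, of "\<lambda>_. 1" "\<lambda>_. 1" c 0] by simp
qed

lemma vector_field_add:
  assumes "X \<in> vector_fields \<A>" "smooth_fun \<A> f" "smooth_fun \<A> g"
  shows "X (\<lambda>x. f x + g x) = (\<lambda>x. X f x + X g x)"
  using vector_field_linear[OF assms, of 1 1] by simp

lemma vector_field_minus:
  assumes "X \<in> vector_fields \<A>" "smooth_fun \<A> f"
  shows "X (\<lambda>x. - f x) = (\<lambda>x. - X f x)"
  using vector_field_linear[OF assms assms(2), of "-1" 0] by simp

lemma vector_field_diff: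
  assumes "X \<in> vector_fields \<A>" "smooth_fun \<A> f" "smooth_fun \<A> g"
  shows "X (\<lambda>x. f x - g x) = (\<lambda>x. X f x - X g x)"
  using vector_field_linear[OF assms, of 1 "-1"] by simp

lemma vector_field_combination:
  assumes "smooth_atlas \<A>" and Y: "Y \<in> vector_fields \<A>" and Z: "Z \<in> vector_fields \<A>"
    and "smooth_fun \<A> f" "smooth_fun \<A> g"
  shows "(\<lambda>h x. f x * Y h x + g x * Z h x) \<in> vector_fields \<A>" (is "?W \<in> _")
proof -
  have 1: "smooth_fun \<A> h \<Longrightarrow> smooth_fun \<A> (?W h)" for h
    by (intro smooth_fun_add smooth_fun_mult vector_field_smooth[OF Y] vector_field_smooth[OF Z] assms)
  have 2: "\<not> smooth_fun \<A> h \<Longrightarrow> ?W h = (\<lambda>_. 0)" for h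
    by (simp add: vector_field_nonsmooth[OF Y] vector_field_nonsmooth[OF Z])
  have 3: "?W (\<lambda>x. b * h x + c * k x) = (\<lambda>x. b * ?W h x + c * ?W k x)"
    if "smooth_fun \<A> h" "smooth_fun \<A> k" for h k b c
    using that by (simp add: vector_field_linear[OF Y] vector_field_linear[OF Z] algebra_simps)
  have 4: "?W (\<lambda>x. h x * k x) = (\<lambda>x. h x * ?W k x + ?W h x * k x)"
    if "smooth_fun \<A> h" "smooth_fun \<A> k" for h k
    using that by (simp add: vector_field_mult[OF Y] vector_field_mult[OF Z] algebra_simps)
  show ?thesis using 1 2 3 4 by (simp add: vector_fields_def)
qed

text \<open>The cross terms X f * Y g of the two iterated product rules cancel. On non-smooth
  functions the iterated values are those of X or Y on the zero function.\<close>

lemma lie_bracket_vector_field: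
  assumes "smooth_atlas \<A>" and X: "X \<in> vector_fields \<A>" and Y: "Y \<in> vector_fields \<A>"
  shows "lie_bracket X Y \<in> vector_fields \<A>"
proof -
  note sm = vector_field_smooth[OF X] vector_field_smooth[OF Y]
  have 1: "smooth_fun \<A> f \<Longrightarrow> smooth_fun \<A> (lie_bracket X Y f)" for f
    unfolding lie_bracket_def by (intro smooth_fun_diff assms sm)
  have 2: "\<not> smooth_fun \<A> f \<Longrightarrow> lie_bracket X Y f = (\<lambda>_. 0)" for f
    by (simp add: lie_bracket_def vector_field_nonsmooth[OF X] vector_field_nonsmooth[OF Y]
        vector_field_const[OF X] vector_field_const[OF Y])
  have 3: "lie_bracket X Y (\<lambda>x. b * f x + c * g x) =
      (\<lambda>x. b * lie_bracket X Y f x + c * lie_bracket X Y g x)"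
    if "smooth_fun \<A> f" "smooth_fun \<A> g" for f g b c
    using that by (simp add: lie_bracket_def vector_field_linear[OF X] vector_field_linear[OF Y] sm
        algebra_simps)
  have 4: "lie_bracket X Y (\<lambda>x. f x * g x) =
      (\<lambda>x. f x * lie_bracket X Y g x + lie_bracket X Y f x * g x)"
    if "smooth_fun \<A> f" "smooth_fun \<A> g" for f g
    using that by (simp add: lie_bracket_def vector_field_mult[OF X] vector_field_mult[OF Y] sm
        vector_field_add[OF X] vector_field_add[OF Y] smooth_fun_mult[OF assms(1)] algebra_simps)
  show ?thesis using 1 2 3 4 by (simp add: vector_fields_def)
qed

lemma lie_bracket_swap: "lie_bracket Y X = (\<lambda>h x. - lie_bracket X Y h x)"
  by (simp add: lie_bracket_def)

text \<open>The bracket order is the one in which the Koszul formula for a 2-form produces double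
  brackets. The identity is wanted for every h, smooth or not, so that it becomes an equality of
  vector fields to which a form can be applied.\<close>

lemma jacobi:
  assumes X: "X \<in> vector_fields \<A>" and Y: "Y \<in> vector_fields \<A>" and Z: "Z \<in> vector_fields \<A>"
  shows "lie_bracket (lie_bracket X Y) Z h x =
    lie_bracket (lie_bracket X Z) Y h x - lie_bracket (lie_bracket Y Z) X h x"
proof (cases "smooth_fun \<A> h")
  case True
  then show ?thesis
    by (simp add: lie_bracket_def vector_field_diff[OF X] vector_field_diff[OF Y]
        vector_field_diff[OF Z] vector_field_smooth[OF X] vector_field_smooth[OF Y] vector_field_smooth[OF Z])
next
  case False
  then show ?thesis
    by (simp add: lie_bracket_def vector_field_nonsmooth[OF X] vector_field_nonsmooth[OF Y]
        vector_field_nonsmooth[OF Z]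
        vector_field_const[OF X] vector_field_const[OF Y] vector_field_const[OF Z])
qed

text \<open>The terms with X f and X g are what makes d linear over functions: they cancel those
  from differentiating the coefficients of a combination.\<close>

lemma lie_bracket_combination:
  assumes "smooth_atlas \<A>" and Y: "Y \<in> vector_fields \<A>" and Z: "Z \<in> vector_fields \<A>"
    and X: "X \<in> vector_fields \<A>" and "smooth_fun \<A> f" "smooth_fun \<A> g"
  shows "lie_bracket (\<lambda>h x. f x * Y h x + g x * Z h x) X h x =
    f x * lie_bracket Y X h x + g x * lie_bracket Z X h x - X f x * Y h x - X g x * Z h x"
proof (cases "smooth_fun \<A> h")
  case True
  then show ?thesis
    using assms(5,6)
    by (simp add: lie_bracket_def vector_field_add[OF X] vector_field_mult[OF X]
        smooth_fun_mult[OF assms(1)] vector_field_smooth[OF Y] vector_field_smooth[OF Z] algebra_simps)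
next
  case False
  then show ?thesis
    by (simp add: lie_bracket_def vector_field_nonsmooth[OF X] vector_field_nonsmooth[OF Y]
        vector_field_nonsmooth[OF Z]
        vector_field_const[OF X])
qed

section \<open>Vector fields acting on complex-valued functions\<close>

lemma derive_complex_smooth:
  assumes "smooth_atlas \<A>" "X \<in> vector_fields \<A>" "smooth_fun \<A> f"
  shows "smooth_fun \<A> (derive_complex X f)"
  unfolding derive_complex_def using assms
  by (intro smooth_fun_Complex smooth_fun_Re smooth_fun_Im vector_field_smooth[OF assms(2)])

lemma derive_complex_add:
  assumes "smooth_atlas \<A>" "X \<in> vector_fields \<A>" "smooth_fun \<A> f" "smooth_fun \<A> g"
  shows "derive_complex X (\<lambda>x. f x + g x) = (\<lambda>x. derive_complex X f x + derive_complex X g x)"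
  using assms(3-)
  by (simp add: derive_complex_def vector_field_add[OF assms(2)] smooth_fun_Re[OF assms(1)]
      smooth_fun_Im[OF assms(1)] smooth_fun_mult[OF assms(1)] complex_eq_iff fun_eq_iff)

lemma derive_complex_diff:
  assumes "smooth_atlas \<A>" "X \<in> vector_fields \<A>" "smooth_fun \<A> f" "smooth_fun \<A> g"
  shows "derive_complex X (\<lambda>x. f x - g x) = (\<lambda>x. derive_complex X f x - derive_complex X g x)"
  using assms(3-)
  by (simp add: derive_complex_def vector_field_diff[OF assms(2)] smooth_fun_Re[OF assms(1)]
      smooth_fun_Im[OF assms(1)] smooth_fun_mult[OF assms(1)] complex_eq_iff fun_eq_iff)

lemma derive_complex_mult:
  assumes "smooth_atlas \<A>" "X \<in> vector_fields \<A>" "smooth_fun \<A> f" "smooth_fun \<A> g"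
  shows "derive_complex X (\<lambda>x. f x * g x) = (\<lambda>x. f x * derive_complex X g x + derive_complex X f x * g x)"
  using assms(3-)
  by (simp add: derive_complex_def vector_field_add[OF assms(2)] vector_field_diff[OF assms(2)]
      vector_field_mult[OF assms(2)] smooth_fun_Re[OF assms(1)]
      smooth_fun_Im[OF assms(1)] smooth_fun_mult[OF assms(1)] complex_eq_iff fun_eq_iff)

lemma derive_complex_const:
  assumes "X \<in> vector_fields \<A>"
  shows "derive_complex X (\<lambda>_. c) = (\<lambda>_. 0)"
  by (simp add: derive_complex_def vector_field_const[OF assms] complex_eq_iff fun_eq_iff)

lemma derive_complex_cmult:
  assumes "smooth_atlas \<A>" "X \<in> vector_fields \<A>" "smooth_fun \<A> f"
  shows "derive_complex X (\<lambda>x. c * f x) = (\<lambda>x. c * derive_complex X f x)"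
  using derive_complex_mult[OF assms(1,2) smooth_fun_const assms(3)]
    derive_complex_const[OF assms(2)] by simp

lemma derive_complex_sum:
  assumes "smooth_atlas \<A>" "X \<in> vector_fields \<A>" "\<And>i. i \<in> I \<Longrightarrow> smooth_fun \<A> (f i)"
  shows "derive_complex X (\<lambda>x. \<Sum>i\<in>I. f i x) = (\<lambda>x. \<Sum>i\<in>I. derive_complex X (f i) x)"
  using assms(3)
  by (induction I rule: infinite_finite_induct)
    (simp_all add: derive_complex_const[OF assms(2)] derive_complex_add[OF assms(1,2)]
      smooth_fun_sum[OF assms(1)])

lemma derive_complex_cnj:
  assumes "smooth_atlas \<A>" "X \<in> vector_fields \<A>" "smooth_fun \<A> f"
  shows "derive_complex X (\<lambda>x. cnj (f x)) = (\<lambda>x. cnj (derive_complex X f x))"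
  using assms(3-)
  by (simp add: derive_complex_def vector_field_minus[OF assms(2)] smooth_fun_Re[OF assms(1)]
      smooth_fun_Im[OF assms(1)] smooth_fun_mult[OF assms(1)] complex_eq_iff fun_eq_iff)

lemma derive_complex_of_real:
  assumes "X \<in> vector_fields \<A>"
  shows "derive_complex X (\<lambda>x. complex_of_real (f x)) = (\<lambda>x. complex_of_real (X f x))"
  by (simp add: derive_complex_def vector_field_const[OF assms] complex_eq_iff fun_eq_iff)

lemma derive_complex_lie_bracket:
  "derive_complex (lie_bracket X Y) f x =
    derive_complex X (derive_complex Y f) x - derive_complex Y (derive_complex X f) x"
  by (simp add: derive_complex_def lie_bracket_def complex_eq_iff)

lemma derive_complex_combination:
  "derive_complex (\<lambda>h x. f x * Y h x + g x * Z h x) k x =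
    complex_of_real (f x) * derive_complex Y k x + complex_of_real (g x) * derive_complex Z k x"
  by (simp add: derive_complex_def complex_eq_iff)


section \<open>The wedge product\<close>

lemma wedge_Nil: "(\<omega> \<^bold>\<and> \<eta>) [] x = \<omega> [] x * \<eta> [] x"
  by (simp add: wedge_def shuffle_sign_def)

lemma shuffle_sign_Suc_image:
  assumes "T \<subseteq> {..<n}"
  shows "shuffle_sign (Suc n) (Suc ` T) = (-1) ^ card T * shuffle_sign n T"
proof -
  let ?P = "{(i, j). i \<in> T \<and> j \<in> {..<n} - T \<and> j < i}"
  have fin: "finite T" using assms finite_subset by blast
  have finP: "finite ?P"
    by (rule finite_subset[of _ "T \<times> {..<n}"]) (use fin in auto)
  have eq: "{(i, j). i \<in> Suc ` T \<and> j \<in> {..<Suc n} - Suc ` T \<and> j < i} =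
      (\<lambda>i. (Suc i, 0)) ` T \<union> (\<lambda>(i, j). (Suc i, Suc j)) ` ?P" (is "?L = ?A \<union> ?B")
  proof (intro equalityI subsetI)
    fix p assume "p \<in> ?L"
    then show "p \<in> ?A \<union> ?B"
      by (cases p; cases "snd p") (auto simp: image_iff)
  qed auto
  have "card ?L = card ?A + card ?B"
    unfolding eq by (rule card_Un_disjoint) (use fin finP in auto)
  also have "card ?A = card T" by (rule card_image) (auto simp: inj_on_def)
  also have "card ?B = card ?P" by (rule card_image) (auto simp: inj_on_def)
  finally show ?thesis by (simp add: shuffle_sign_def power_add)
qed

text \<open>Position 0 belongs to the selected set and comes first, so it creates no
  inversion.\<close>

lemma shuffle_sign_insert_0:
  "shuffle_sign (Suc n) (insert 0 (Suc ` T)) = shuffle_sign n T"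
proof -
  let ?P = "{(i, j). i \<in> T \<and> j \<in> {..<n} - T \<and> j < i}"
  have eq: "{(i, j). i \<in> insert 0 (Suc ` T) \<and> j \<in> {..<Suc n} - insert 0 (Suc ` T) \<and> j < i} =
      (\<lambda>(i, j). (Suc i, Suc j)) ` ?P" (is "?L = ?B")
  proof (intro equalityI subsetI)
    fix p assume "p \<in> ?L"
    then show "p \<in> ?B"
      by (cases p; cases "snd p") (auto simp: image_iff)
  qed auto
  have "card ?B = card ?P" by (rule card_image) (auto simp: inj_on_def)
  then show ?thesis using eq by (simp add: shuffle_sign_def)
qed

lemma Pow_lessThan_Suc:
  "Pow {..<Suc n} = (\<lambda>T. insert 0 (Suc ` T)) ` Pow {..<n} \<union> (\<lambda>T. Suc ` T) ` Pow {..<n}"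
    (is "_ = ?A \<union> ?B")
proof (intro equalityI subsetI)
  fix S assume S: "S \<in> Pow {..<Suc n}"
  define T where "T = {i. Suc i \<in> S}"
  have "T \<in> Pow {..<n}" using S by (auto simp: T_def)
  moreover have "S = (if 0 \<in> S then insert 0 (Suc ` T) else Suc ` T)"
  proof (rule set_eqI)
    fix i show "i \<in> S \<longleftrightarrow> i \<in> (if 0 \<in> S then insert 0 (Suc ` T) else Suc ` T)"
      by (cases i) (auto simp: T_def)
  qed
  ultimately show "S \<in> ?A \<union> ?B" by (cases "0 \<in> S") auto
qed auto

text \<open>Whether the first vector field goes to the left or to the right factor: this recursion
  replaces all combinatorics of shuffles by induction over the list of arguments.\<close>

lemma wedge_Cons:
  "(\<omega> \<^bold>\<and> \<eta>) (X # Xs) x =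
    ((\<lambda>Ys. \<omega> (X # Ys)) \<^bold>\<and> \<eta>) Xs x
    + ((\<lambda>Ys x. (-1) ^ length Ys * \<omega> Ys x) \<^bold>\<and> (\<lambda>Ys. \<eta> (X # Ys))) Xs x"
proof -
  let ?n = "length Xs"
  let ?f = "\<lambda>S. shuffle_sign (Suc ?n) S * \<omega> (nths (X # Xs) S) x * \<eta> (nths (X # Xs) (- S)) x"
  let ?A = "(\<lambda>T. insert 0 (Suc ` T)) ` Pow {..<?n}" and ?B = "(\<lambda>T. Suc ` T) ` Pow {..<?n}"
  \<comment> \<open>Converts the sign from the number of selected positions to the length of the
    argument list of \<open>\<omega>\<close>. Only in this form is the second summand again a wedge
    product.\<close>
  have len: "length (nths Xs T) = card T" if "T \<subseteq> {..<?n}" for T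
  proof -
    have "{i. i < length Xs \<and> i \<in> T} = T" using that by auto
    then show ?thesis by (simp add: length_nths)
  qed
  have compl: "{j. Suc j \<notin> Suc ` T} = - T" "{j. Suc j \<in> Suc ` T} = T" for T by auto
  have "(\<omega> \<^bold>\<and> \<eta>) (X # Xs) x = sum ?f (?A \<union> ?B)"
    by (simp only: wedge_def length_Cons Pow_lessThan_Suc)
  also have "\<dots> = sum ?f ?A + sum ?f ?B"
    by (rule sum.union_disjoint) auto
  also have "sum ?f ?A = (\<Sum>T\<in>Pow {..<?n}. ?f (insert 0 (Suc ` T)))"
    by (rule sum.reindex_cong[of "\<lambda>T. insert 0 (Suc ` T)"]) (auto simp: inj_on_def)
  also have "\<dots> = ((\<lambda>Ys. \<omega> (X # Ys)) \<^bold>\<and> \<eta>) Xs x"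
    unfolding wedge_def by (rule sum.cong) (simp_all add: nths_Cons shuffle_sign_insert_0 compl)
  also have "sum ?f ?B = (\<Sum>T\<in>Pow {..<?n}. ?f (Suc ` T))"
    by (rule sum.reindex_cong[of "\<lambda>T. Suc ` T"]) (auto simp: inj_on_def inj_image_eq_iff)
  also have "\<dots> = ((\<lambda>Ys x. (-1) ^ length Ys * \<omega> Ys x) \<^bold>\<and> (\<lambda>Ys. \<eta> (X # Ys))) Xs x"
    unfolding wedge_def by (rule sum.cong) (auto simp add: nths_Cons shuffle_sign_Suc_image compl len)
  finally show ?thesis .
qed

lemma wedge_add_left: "(\<omega> + \<omega>') \<^bold>\<and> \<eta> = \<omega> \<^bold>\<and> \<eta> + \<omega>' \<^bold>\<and> \<eta>"
  by (simp add: fun_eq_iff wedge_def algebra_simps sum.distrib)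

lemma wedge_add_right: "\<omega> \<^bold>\<and> (\<eta> + \<eta>') = \<omega> \<^bold>\<and> \<eta> + \<omega> \<^bold>\<and> \<eta>'"
  by (simp add: fun_eq_iff wedge_def algebra_simps sum.distrib)

lemma wedge_scale_left: "scale_form c \<omega> \<^bold>\<and> \<eta> = scale_form c (\<omega> \<^bold>\<and> \<eta>)"
  by (simp add: fun_eq_iff wedge_def scale_form_def sum_distrib_left algebra_simps)

lemma wedge_scale_right: "\<omega> \<^bold>\<and> scale_form c \<eta> = scale_form c (\<omega> \<^bold>\<and> \<eta>)"
  by (simp add: fun_eq_iff wedge_def scale_form_def sum_distrib_left algebra_simps)

lemma wedge_minus_left: "(- \<omega>) \<^bold>\<and> \<eta> = - (\<omega> \<^bold>\<and> \<eta>)"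
  by (simp add: fun_eq_iff wedge_def sum_negf)

lemma wedge_minus_right: "\<omega> \<^bold>\<and> (- \<eta>) = - (\<omega> \<^bold>\<and> \<eta>)"
  by (simp add: fun_eq_iff wedge_def sum_negf)

lemma wedge_diff_left: "(\<omega> - \<omega>') \<^bold>\<and> \<eta> = \<omega> \<^bold>\<and> \<eta> - \<omega>' \<^bold>\<and> \<eta>"
  by (simp add: fun_eq_iff wedge_def algebra_simps sum_subtractf)

lemma wedge_diff_right: "\<omega> \<^bold>\<and> (\<eta> - \<eta>') = \<omega> \<^bold>\<and> \<eta> - \<omega> \<^bold>\<and> \<eta>'"
  by (simp add: fun_eq_iff wedge_def algebra_simps sum_subtractf)

lemma wedge_zero_left: "(\<lambda>_ _. 0) \<^bold>\<and> \<eta> = 0"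
  by (simp add: fun_eq_iff wedge_def)

lemma wedge_zero_right: "\<omega> \<^bold>\<and> (\<lambda>_ _. 0) = 0"
  by (simp add: fun_eq_iff wedge_def)

text \<open>The lengths of the two argument lists add up to the total length, so the sign by degree
  is multiplicative. The recursion puts this sign on the left factor, which may itself be a
  product.\<close>

lemma wedge_parity:
  "(\<lambda>Ys x. (-1) ^ length Ys * (\<omega> \<^bold>\<and> \<eta>) Ys x) =
    (\<lambda>Ys x. (-1) ^ length Ys * \<omega> Ys x) \<^bold>\<and> (\<lambda>Ys x. (-1) ^ length Ys * \<eta> Ys x)"
proof (rule ext, rule ext)
  fix Ys x
  show "(-1) ^ length Ys * (\<omega> \<^bold>\<and> \<eta>) Ys x =
    ((\<lambda>Ys x. (-1) ^ length Ys * \<omega> Ys x) \<^bold>\<and> (\<lambda>Ys x. (-1) ^ length Ys * \<eta> Ys x)) Ys x"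
  proof (induction Ys arbitrary: \<omega> \<eta>)
    case Nil
    then show ?case by (simp add: wedge_Nil)
  next
    case (Cons X Ys)
    have neg: "(\<lambda>Zs x. - f Zs x) = - f" for f :: "'a form" by (simp add: fun_eq_iff)
    show ?case
      using Cons.IH[of "\<lambda>Zs. \<omega> (X # Zs)" \<eta>]
        Cons.IH[of "\<lambda>Zs x. (-1) ^ length Zs * \<omega> Zs x" "\<lambda>Zs. \<eta> (X # Zs)"]
      by (simp add: wedge_Cons neg wedge_minus_left wedge_minus_right algebra_simps)
  qed
qed

text \<open>By the recursion both sides become the same three products, according to which factor
  receives the first vector field. The induction generalises over the factors because the recursion
  changes them.\<close>

lemma wedge_assoc: "(\<omega> \<^bold>\<and> \<eta>) \<^bold>\<and> \<zeta> = \<omega> \<^bold>\<and> (\<eta> \<^bold>\<and> \<zeta>)"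
proof (rule ext, rule ext)
  fix Xs x
  show "((\<omega> \<^bold>\<and> \<eta>) \<^bold>\<and> \<zeta>) Xs x = (\<omega> \<^bold>\<and> (\<eta> \<^bold>\<and> \<zeta>)) Xs x"
  proof (induction Xs arbitrary: \<omega> \<eta> \<zeta>)
    case Nil
    then show ?case by (simp add: wedge_Nil)
  next
    case (Cons X Xs)
    have 1: "(\<lambda>Ys. (\<alpha> \<^bold>\<and> \<beta>) (X # Ys)) = (\<lambda>Ys. \<alpha> (X # Ys)) \<^bold>\<and> \<beta> +
       (\<lambda>Ys x. (-1) ^ length Ys * \<alpha> Ys x) \<^bold>\<and> (\<lambda>Ys. \<beta> (X # Ys))" for \<alpha> \<beta> :: "'a form"
      by (simp add: fun_eq_iff wedge_Cons)
    show ?case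
      by (simp add: wedge_Cons[of "\<omega> \<^bold>\<and> \<eta>"] wedge_Cons[of \<omega>] 1 wedge_add_left wedge_add_right
          wedge_parity Cons.IH)
  qed
qed

text \<open>Handing the first vector field to a factor lowers its degree by one, so the degrees vary
  along the induction.\<close>

lemma wedge_graded_commute:
  assumes "\<And>Xs. length Xs \<noteq> k \<Longrightarrow> \<omega> Xs = (\<lambda>_. 0)" "\<And>Xs. length Xs \<noteq> l \<Longrightarrow> \<eta> Xs = (\<lambda>_. 0)"
  shows "\<omega> \<^bold>\<and> \<eta> = scale_form ((-1) ^ (k * l)) (\<eta> \<^bold>\<and> \<omega>)"
proof (rule ext, rule ext)
  fix Xs x
  show "(\<omega> \<^bold>\<and> \<eta>) Xs x = scale_form ((-1) ^ (k * l)) (\<eta> \<^bold>\<and> \<omega>) Xs x"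
    using assms
  proof (induction Xs arbitrary: \<omega> \<eta> k l)
    case Nil
    then show ?case
      by (cases "k = 0"; cases "l = 0") (simp_all add: wedge_Nil scale_form_def)
  next
    case (Cons X Xs)
    have par: "(\<lambda>Ys x. (-1) ^ length Ys * \<alpha> Ys x) = scale_form ((-1) ^ m) \<alpha>"
      if "\<And>Xs. length Xs \<noteq> m \<Longrightarrow> \<alpha> Xs = (\<lambda>_. 0)" for \<alpha> :: "'a form" and m
    proof (rule ext, rule ext)
      fix Ys x
      show "(-1) ^ length Ys * \<alpha> Ys x = scale_form ((-1) ^ m) \<alpha> Ys x"
        using that by (cases "length Ys = m") (simp_all add: scale_form_def)
    qed
    \<comment> \<open>Since (m - 1) n and m n + n have the same parity, the exponent avoids
      subtraction. This also covers m = 0, where \<open>\<alpha> (X # Ys)\<close> vanishes.\<close>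
    have left: "((\<lambda>Ys. \<alpha> (X # Ys)) \<^bold>\<and> \<beta>) Xs x =
        (-1) ^ (m * n + n) * (\<beta> \<^bold>\<and> (\<lambda>Ys. \<alpha> (X # Ys))) Xs x"
      if "\<And>Xs. length Xs \<noteq> m \<Longrightarrow> \<alpha> Xs = (\<lambda>_. 0)" "\<And>Xs. length Xs \<noteq> n \<Longrightarrow> \<beta> Xs = (\<lambda>_. 0)"
      for \<alpha> \<beta> :: "'a form" and m n
    proof (cases m)
      case 0
      then show ?thesis using that(1) by (simp add: wedge_zero_left wedge_zero_right)
    next
      case (Suc m')
      have "((\<lambda>Ys. \<alpha> (X # Ys)) \<^bold>\<and> \<beta>) Xs x =
        scale_form ((-1) ^ (m' * n)) (\<beta> \<^bold>\<and> (\<lambda>Ys. \<alpha> (X # Ys))) Xs x"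
        by (rule Cons.IH) (use that Suc in auto)
      moreover have "(-1 :: complex) ^ (m * n + n) = (-1) ^ (m' * n)"
        using Suc by (simp add: power_add flip: power_mult_distrib)
      ultimately show ?thesis by (simp add: scale_form_def)
    qed
    have sq: "(-1 :: complex) ^ n * ((-1) ^ n * z) = z" for n z
      by (simp flip: mult.assoc power_mult_distrib)
    have par': "(\<lambda>Ys x. (-1) ^ length Ys * \<omega> Ys x) = scale_form ((-1) ^ k) \<omega>"
      "(\<lambda>Ys x. (-1) ^ length Ys * \<eta> Ys x) = scale_form ((-1) ^ l) \<eta>"
      by (rule par, rule Cons.prems, assumption)+
    have left': "((\<lambda>Ys. \<omega> (X # Ys)) \<^bold>\<and> \<eta>) Xs x =
        (-1) ^ (k * l + l) * (\<eta> \<^bold>\<and> (\<lambda>Ys. \<omega> (X # Ys))) Xs x"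
      "((\<lambda>Ys. \<eta> (X # Ys)) \<^bold>\<and> \<omega>) Xs x =
        (-1) ^ (l * k + k) * (\<omega> \<^bold>\<and> (\<lambda>Ys. \<eta> (X # Ys))) Xs x"
      by (rule left; rule Cons.prems; assumption)+
    have "(\<omega> \<^bold>\<and> \<eta>) (X # Xs) x = (-1) ^ (k * l) * (\<eta> \<^bold>\<and> \<omega>) (X # Xs) x"
      unfolding wedge_Cons par' wedge_scale_left left'
      unfolding scale_form_def
      by (simp add: power_add mult.commute[of l k] sq algebra_simps)
    then show ?case by (simp add: scale_form_def)
  qed
qed


section \<open>Differential forms\<close>

text \<open>The vanishing clause of \<open>is_form\<close> on its own. It passes through wedge
  products and d in every degree, and it is enough for the sign rules and for proving equality by
  evaluation.\<close>

definition supported :: "('m, 'e::euclidean_space) atlas \<Rightarrow> nat \<Rightarrow> 'm form \<Rightarrow> bool" where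
  "supported \<A> k \<omega> \<longleftrightarrow>
     (\<forall>Xs. \<not> (length Xs = k \<and> set Xs \<subseteq> vector_fields \<A>) \<longrightarrow> \<omega> Xs = (\<lambda>_. 0))"

lemma supported_length: "supported \<A> k \<omega> \<Longrightarrow> length Xs \<noteq> k \<Longrightarrow> \<omega> Xs = (\<lambda>_. 0)"
  by (simp add: supported_def)

lemma is_form_supported: "is_form \<A> k \<omega> \<Longrightarrow> supported \<A> k \<omega>"
  by (simp add: is_form_def supported_def)

lemma supported_eqI:
  assumes "supported \<A> k \<omega>" "supported \<A> k \<eta>"
    and "\<And>Xs x. length Xs = k \<Longrightarrow> set Xs \<subseteq> vector_fields \<A> \<Longrightarrow> \<omega> Xs x = \<eta> Xs x"
  shows "\<omega> = \<eta>"
proof (intro ext)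
  fix Xs x
  show "\<omega> Xs x = \<eta> Xs x"
    using assms(1,2) assms(3)[of Xs x] unfolding supported_def
    by (cases "length Xs = k \<and> set Xs \<subseteq> vector_fields \<A>") simp_all
qed

lemma supported_add: "supported \<A> k \<omega> \<Longrightarrow> supported \<A> k \<eta> \<Longrightarrow> supported \<A> k (\<omega> + \<eta>)"
  by (simp add: supported_def fun_eq_iff)

lemma supported_diff: "supported \<A> k \<omega> \<Longrightarrow> supported \<A> k \<eta> \<Longrightarrow> supported \<A> k (\<omega> - \<eta>)"
  by (simp add: supported_def fun_eq_iff)

lemma supported_scale: "supported \<A> k \<omega> \<Longrightarrow> supported \<A> k (scale_form c \<omega>)"
  by (simp add: supported_def scale_form_def)

text \<open>A shuffle splits \<open>Xs\<close> into complementary sublists. If neither factor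
  vanishes on its part, the lengths add up to k + l and all entries are vector fields.\<close>

lemma supported_wedge:
  assumes "supported \<A> k \<omega>" "supported \<A> l \<eta>"
  shows "supported \<A> (k + l) (\<omega> \<^bold>\<and> \<eta>)"
  unfolding supported_def
proof (intro allI impI)
  fix Xs assume not: "\<not> (length Xs = k + l \<and> set Xs \<subseteq> vector_fields \<A>)"
  have "\<omega> (nths Xs S) x * \<eta> (nths Xs (- S)) x = 0" for S x
  proof (rule ccontr)
    assume "\<omega> (nths Xs S) x * \<eta> (nths Xs (- S)) x \<noteq> 0"
    then have *: "length (nths Xs S) = k \<and> set (nths Xs S) \<subseteq> vector_fields \<A>"
      "length (nths Xs (- S)) = l \<and> set (nths Xs (- S)) \<subseteq> vector_fields \<A>"
      using assms unfolding supported_def by (metis mult_zero_left mult_zero_right)+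
    have "length (nths Xs S) + length (nths Xs (- S)) =
        card ({i. i < length Xs \<and> i \<in> S} \<union> {i. i < length Xs \<and> i \<in> - S})"
      by (subst card_Un_disjoint) (auto simp: length_nths)
    also have "{i. i < length Xs \<and> i \<in> S} \<union> {i. i < length Xs \<and> i \<in> - S} = {..<length Xs}" by auto
    finally have "length Xs = k + l" using * by simp
    moreover have "set Xs = set (nths Xs S) \<union> set (nths Xs (- S))"
      unfolding set_nths set_conv_nth[of Xs] by blast
    ultimately show False using * not by auto
  qed
  then show "(\<omega> \<^bold>\<and> \<eta>) Xs = (\<lambda>_. 0)"
    unfolding wedge_def mult.assoc by (simp only: mult_zero_right sum.neutral_const)
qed

lemma wedge_commute:
  assumes "supported \<A> k \<omega>" "supported \<A> l \<eta>" "even (k * l)"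
  shows "\<omega> \<^bold>\<and> \<eta> = \<eta> \<^bold>\<and> \<omega>"
  using wedge_graded_commute[OF supported_length[OF assms(1)] supported_length[OF assms(2)]] assms(3)
  by (simp add: scale_form_def)

lemma wedge_anticommute:
  assumes "supported \<A> k \<omega>" "supported \<A> l \<eta>" "odd (k * l)"
  shows "\<omega> \<^bold>\<and> \<eta> = - (\<eta> \<^bold>\<and> \<omega>)"
  using wedge_graded_commute[OF supported_length[OF assms(1)] supported_length[OF assms(2)]] assms(3)
  by (simp add: scale_form_def fun_eq_iff)

lemma wedge_self:
  assumes "supported \<A> k \<omega>" "odd k"
  shows "\<omega> \<^bold>\<and> \<omega> = 0"
  using wedge_anticommute[OF assms(1,1)] assms(2) by (simp add: fun_eq_iff)

section \<open>Wedge products of low degree on explicit arguments\<close>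

lemma wedge_1_1:
  assumes "supported \<A> 1 \<alpha>" "supported \<A> 1 \<beta>"
  shows "(\<alpha> \<^bold>\<and> \<beta>) [X, Y] x = \<alpha> [X] x * \<beta> [Y] x - \<alpha> [Y] x * \<beta> [X] x"
  using assms[THEN supported_length] by (simp add: wedge_Cons wedge_Nil)

lemma wedge_1_2:
  assumes "supported \<A> 1 \<alpha>" "supported \<A> 2 \<beta>"
  shows "(\<alpha> \<^bold>\<and> \<beta>) [X, Y, Z] x =
    \<alpha> [X] x * \<beta> [Y, Z] x - \<alpha> [Y] x * \<beta> [X, Z] x + \<alpha> [Z] x * \<beta> [X, Y] x"
  using assms[THEN supported_length] by (simp add: wedge_Cons wedge_Nil)

lemma wedge_2_1:
  assumes "supported \<A> 2 \<alpha>" "supported \<A> 1 \<beta>"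
  shows "(\<alpha> \<^bold>\<and> \<beta>) [X, Y, Z] x =
    \<alpha> [X, Y] x * \<beta> [Z] x - \<alpha> [X, Z] x * \<beta> [Y] x + \<alpha> [Y, Z] x * \<beta> [X] x"
  using assms[THEN supported_length] by (simp add: wedge_Cons wedge_Nil)

lemma wedge_1_3:
  assumes "supported \<A> 1 \<alpha>" "supported \<A> 3 \<beta>"
  shows "(\<alpha> \<^bold>\<and> \<beta>) [X, Y, Z, W] x =
    \<alpha> [X] x * \<beta> [Y, Z, W] x - \<alpha> [Y] x * \<beta> [X, Z, W] x
    + \<alpha> [Z] x * \<beta> [X, Y, W] x - \<alpha> [W] x * \<beta> [X, Y, Z] x"
  using assms[THEN supported_length] by (simp add: wedge_Cons wedge_Nil)

lemma wedge_2_2: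
  assumes "supported \<A> 2 \<alpha>" "supported \<A> 2 \<beta>"
  shows "(\<alpha> \<^bold>\<and> \<beta>) [X, Y, Z, W] x =
    \<alpha> [X, Y] x * \<beta> [Z, W] x - \<alpha> [X, Z] x * \<beta> [Y, W] x + \<alpha> [X, W] x * \<beta> [Y, Z] x
    + \<alpha> [Y, Z] x * \<beta> [X, W] x - \<alpha> [Y, W] x * \<beta> [X, Z] x + \<alpha> [Z, W] x * \<beta> [X, Y] x"
  using assms[THEN supported_length] by (simp add: wedge_Cons wedge_Nil)

section \<open>Multilinearity and alternation of forms of degree at most 3\<close>

lemma is_form_smooth: "is_form \<A> k \<omega> \<Longrightarrow> smooth_fun \<A> (\<omega> Xs)"
  by (cases "length Xs = k \<and> set Xs \<subseteq> vector_fields \<A>") (simp_all add: is_form_def)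

lemma is_form_combination:
  assumes "is_form \<A> k \<omega>" "length Xs = k" "set Xs \<subseteq> vector_fields \<A>" "i < k"
    "Y \<in> vector_fields \<A>" "Z \<in> vector_fields \<A>" "smooth_fun \<A> f" "smooth_fun \<A> g"
  shows "\<omega> (Xs[i := (\<lambda>h x. f x * Y h x + g x * Z h x)]) =
    (\<lambda>x. complex_of_real (f x) * \<omega> (Xs[i := Y]) x + complex_of_real (g x) * \<omega> (Xs[i := Z]) x)"
  using assms unfolding is_form_def by blast

lemma is_form_alternating:
  assumes "is_form \<A> k \<omega>" "length Xs = k" "i < k" "j < k" "i \<noteq> j" "Xs ! i = Xs ! j"
  shows "\<omega> Xs = (\<lambda>_. 0)"
  using assms unfolding is_form_def by blast

lemma is_formI:
  assumes "supported \<A> k \<omega>"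
    and "\<And>Xs. length Xs = k \<Longrightarrow> set Xs \<subseteq> vector_fields \<A> \<Longrightarrow> smooth_fun \<A> (\<omega> Xs)"
    and "\<And>Xs i Y Z f g x. length Xs = k \<Longrightarrow> set Xs \<subseteq> vector_fields \<A> \<Longrightarrow> i < k \<Longrightarrow>
      Y \<in> vector_fields \<A> \<Longrightarrow> Z \<in> vector_fields \<A> \<Longrightarrow> smooth_fun \<A> f \<Longrightarrow> smooth_fun \<A> g \<Longrightarrow>
      \<omega> (Xs[i := (\<lambda>h x. f x * Y h x + g x * Z h x)]) x =
        complex_of_real (f x) * \<omega> (Xs[i := Y]) x + complex_of_real (g x) * \<omega> (Xs[i := Z]) x"
    and "\<And>Xs i j x. length Xs = k \<Longrightarrow> set Xs \<subseteq> vector_fields \<A> \<Longrightarrow> i < j \<Longrightarrow> j < k \<Longrightarrow>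
      Xs ! i = Xs ! j \<Longrightarrow> \<omega> Xs x = 0"
  shows "is_form \<A> k \<omega>"
proof -
  have "\<omega> Xs = (\<lambda>_. 0)" if "length Xs = k" "set Xs \<subseteq> vector_fields \<A>" "i < k" "j < k" "i \<noteq> j"
    "Xs ! i = Xs ! j" for Xs i j
    using that assms(4)[of Xs i j] assms(4)[of Xs j i] by (cases i j rule: linorder_cases) auto
  then show ?thesis
    using assms(1-3) unfolding is_form_def supported_def by (auto simp: fun_eq_iff)
qed

lemma is_form_add:
  assumes "smooth_atlas \<A>" "is_form \<A> k \<omega>" "is_form \<A> k \<eta>"
  shows "is_form \<A> k (\<omega> + \<eta>)"
proof (rule is_formI)
  show "supported \<A> k (\<omega> + \<eta>)" by (intro supported_add is_form_supported assms)
  show "smooth_fun \<A> ((\<omega> + \<eta>) Xs)" for Xs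
    unfolding plus_fun_def using smooth_fun_add[OF assms(1) assms(2,3)[THEN is_form_smooth]] .
  show "(\<omega> + \<eta>) Xs x = 0" if "length Xs = k" "i < j" "j < k" "Xs ! i = Xs ! j" for Xs i j x
    using that is_form_alternating[OF assms(2), of Xs i j] is_form_alternating[OF assms(3), of Xs i j] by simp
qed (simp_all add: is_form_combination[OF assms(2)] is_form_combination[OF assms(3)] algebra_simps)

lemma is_form_scale:
  assumes "smooth_atlas \<A>" "is_form \<A> k \<omega>"
  shows "is_form \<A> k (scale_form c \<omega>)"
proof (rule is_formI)
  show "supported \<A> k (scale_form c \<omega>)" by (intro supported_scale is_form_supported assms)
  show "smooth_fun \<A> (scale_form c \<omega> Xs)" for Xs
    unfolding scale_form_def using smooth_fun_mult[OF assms(1) smooth_fun_const is_form_smooth[OF assms(2)]] .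
  show "scale_form c \<omega> Xs x = 0" if "length Xs = k" "i < j" "j < k" "Xs ! i = Xs ! j" for Xs i j x
    using that is_form_alternating[OF assms(2), of Xs i j] by (simp add: scale_form_def)
qed (simp_all add: scale_form_def is_form_combination[OF assms(2)] algebra_simps)

lemma is_form_conj:
  assumes "smooth_atlas \<A>" "is_form \<A> k \<omega>"
  shows "is_form \<A> k (conj_form \<omega>)"
proof (rule is_formI)
  show "supported \<A> k (conj_form \<omega>)"
    using is_form_supported[OF assms(2)] by (simp add: supported_def conj_form_def)
  show "smooth_fun \<A> (conj_form \<omega> Xs)" for Xs
    unfolding conj_form_def using smooth_fun_cnj[OF assms(1) is_form_smooth[OF assms(2)]] .
  show "conj_form \<omega> Xs x = 0" if "length Xs = k" "i < j" "j < k" "Xs ! i = Xs ! j" for Xs i j x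
    using that is_form_alternating[OF assms(2), of Xs i j] by (simp add: conj_form_def)
qed (simp_all add: conj_form_def is_form_combination[OF assms(2)] algebra_simps)

lemma form1_combination:
  assumes "is_form \<A> 1 \<omega>" "Y \<in> vector_fields \<A>" "Z \<in> vector_fields \<A>" "smooth_fun \<A> f" "smooth_fun \<A> g"
  shows "\<omega> [\<lambda>h x. f x * Y h x + g x * Z h x] =
    (\<lambda>x. complex_of_real (f x) * \<omega> [Y] x + complex_of_real (g x) * \<omega> [Z] x)"
  using is_form_combination[OF assms(1), of "[Y]" 0 Y Z f g] assms(2-) by simp

text \<open>Antisymmetry transports linearity from the first slot to the second, and forces
  \<open>\<omega> [X, X] x\<close> to equal its own negative.\<close>

lemma is_form_2I:
  fixes \<omega> :: "'m::{t2_space, second_countable_topology} form"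
  assumes "supported \<A> 2 \<omega>" "\<And>Xs. smooth_fun \<A> (\<omega> Xs)"
    and anti: "\<And>X Y x. X \<in> vector_fields \<A> \<Longrightarrow> Y \<in> vector_fields \<A> \<Longrightarrow> \<omega> [Y, X] x = - \<omega> [X, Y] x"
    and lin: "\<And>X Y Z f g x. X \<in> vector_fields \<A> \<Longrightarrow> Y \<in> vector_fields \<A> \<Longrightarrow> Z \<in> vector_fields \<A> \<Longrightarrow>
      smooth_fun \<A> f \<Longrightarrow> smooth_fun \<A> g \<Longrightarrow>
      \<omega> [\<lambda>h x. f x * Y h x + g x * Z h x, X] x =
        complex_of_real (f x) * \<omega> [Y, X] x + complex_of_real (g x) * \<omega> [Z, X] x"
    and "smooth_atlas \<A>"
  shows "is_form \<A> 2 \<omega>"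
proof (rule is_formI)
  fix Xs i Y Z and f g :: "'m \<Rightarrow> real" and x
  assume *: "length Xs = 2" "set Xs \<subseteq> vector_fields \<A>" "i < (2::nat)" "Y \<in> vector_fields \<A>"
    "Z \<in> vector_fields \<A>" "smooth_fun \<A> f" "smooth_fun \<A> g"
  then obtain X1 X2 where Xs: "Xs = [X1, X2]" "X1 \<in> vector_fields \<A>" "X2 \<in> vector_fields \<A>"
    by (auto simp: numeral_2_eq_2 length_Suc_conv)
  \<comment> \<open>Antisymmetry is assumed only on vector fields and is used with this combination
    as an argument.\<close>
  have W: "(\<lambda>h x. f x * Y h x + g x * Z h x) \<in> vector_fields \<A>"
    using * assms(5) by (intro vector_field_combination)
  show "\<omega> (Xs[i := (\<lambda>h x. f x * Y h x + g x * Z h x)]) x =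
        complex_of_real (f x) * \<omega> (Xs[i := Y]) x + complex_of_real (g x) * \<omega> (Xs[i := Z]) x"
    using *(3) anti[OF W Xs(2)] anti[OF *(4) Xs(2)] anti[OF *(5) Xs(2)] lin[OF Xs(2) *(4-7)] lin[OF Xs(3) *(4-7)]
    by (auto simp: Xs(1) less_2_cases_iff)
next
  fix Xs :: "'m vfield list" and i j x
  assume *: "length Xs = 2" "set Xs \<subseteq> vector_fields \<A>" "i < j" "j < (2::nat)" "Xs ! i = Xs ! j"
  then obtain X where "Xs = [X, X]" "X \<in> vector_fields \<A>"
    by (auto simp: numeral_2_eq_2 length_Suc_conv less_Suc_eq)
  then show "\<omega> Xs x = 0" using anti[of X X x] by simp
qed (rule assms(1), rule assms(2))

text \<open>Polarisation: \<open>is_form\<close> provides only vanishing on repeated arguments, so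
  \<open>\<omega>\<close> is expanded on the pair (X + Y, X + Y).\<close>

lemma form2_antisym:
  assumes "smooth_atlas \<A>" "is_form \<A> 2 \<omega>" "X \<in> vector_fields \<A>" "Y \<in> vector_fields \<A>"
  shows "\<omega> [Y, X] x = - \<omega> [X, Y] x"
proof -
  let ?W = "\<lambda>h x. 1 * X h x + 1 * Y h x"
  have W: "?W \<in> vector_fields \<A>" using assms by (intro vector_field_combination) auto
  have self: "\<omega> [Z, Z] x = 0" for Z
    using is_form_alternating[OF assms(2), of "[Z, Z]" 0 1] by simp
  have "\<omega> [?W, Z] = (\<lambda>x. \<omega> [X, Z] x + \<omega> [Y, Z] x)" "\<omega> [Z, ?W] = (\<lambda>x. \<omega> [Z, X] x + \<omega> [Z, Y] x)"
    if "Z \<in> vector_fields \<A>" for Z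
    using is_form_combination[OF assms(2), of "[Z, Z]" 0 X Y "\<lambda>_. 1" "\<lambda>_. 1"]
      is_form_combination[OF assms(2), of "[Z, Z]" 1 X Y "\<lambda>_. 1" "\<lambda>_. 1"] that assms by simp_all
  from this(1)[OF W] this(2)[OF assms(3)] this(2)[OF assms(4)]
  have "\<omega> [?W, ?W] x = \<omega> [X, X] x + \<omega> [X, Y] x + (\<omega> [Y, X] x + \<omega> [Y, Y] x)" by simp
  then show ?thesis unfolding self using add_eq_0_iff by fastforce
qed

lemma form2_combination:
  assumes "is_form \<A> 2 \<omega>" "X \<in> vector_fields \<A>" "Y \<in> vector_fields \<A>" "Z \<in> vector_fields \<A>"
    "smooth_fun \<A> f" "smooth_fun \<A> g"
  shows "\<omega> [\<lambda>h x. f x * Y h x + g x * Z h x, X] x =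
      complex_of_real (f x) * \<omega> [Y, X] x + complex_of_real (g x) * \<omega> [Z, X] x"
    and "\<omega> [X, \<lambda>h x. f x * Y h x + g x * Z h x] x =
      complex_of_real (f x) * \<omega> [X, Y] x + complex_of_real (g x) * \<omega> [X, Z] x"
  using is_form_combination[OF assms(1), of "[X, X]" 0 Y Z f g]
      is_form_combination[OF assms(1), of "[X, X]" 1 Y Z f g] assms(2-) by simp_all

lemma smooth_fun_wedge:
  assumes "smooth_atlas \<A>" "\<And>Xs. smooth_fun \<A> (\<omega> Xs)" "\<And>Xs. smooth_fun \<A> (\<eta> Xs)"
  shows "smooth_fun \<A> ((\<omega> \<^bold>\<and> \<eta>) Xs)"
  unfolding wedge_def
  by (intro smooth_fun_sum smooth_fun_mult smooth_fun_const assms)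

lemma is_form_wedge_1_1:
  assumes "smooth_atlas \<A>" "is_form \<A> 1 \<alpha>" "is_form \<A> 1 \<beta>"
  shows "is_form \<A> 2 (\<alpha> \<^bold>\<and> \<beta>)"
proof (rule is_form_2I)
  note sup = assms(2,3)[THEN is_form_supported]
  show "supported \<A> 2 (\<alpha> \<^bold>\<and> \<beta>)" using supported_wedge[OF sup] by (simp add: numeral_eq_Suc)
  show "smooth_fun \<A> ((\<alpha> \<^bold>\<and> \<beta>) Xs)" for Xs
    using smooth_fun_wedge[OF assms(1) assms(2,3)[THEN is_form_smooth]] .
  show "(\<alpha> \<^bold>\<and> \<beta>) [\<lambda>h x. f x * Y h x + g x * Z h x, X] x =
        complex_of_real (f x) * (\<alpha> \<^bold>\<and> \<beta>) [Y, X] x + complex_of_real (g x) * (\<alpha> \<^bold>\<and> \<beta>) [Z, X] x"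
    if "X \<in> vector_fields \<A>" "Y \<in> vector_fields \<A>" "Z \<in> vector_fields \<A>"
      "smooth_fun \<A> f" "smooth_fun \<A> g" for X Y Z f g x
    using that by (simp add: wedge_1_1[OF sup] form1_combination[OF assms(2)] form1_combination[OF assms(3)]
        algebra_simps)
qed (use assms(1) in \<open>simp_all add: wedge_1_1[OF assms(2,3)[THEN is_form_supported]]\<close>)

lemma is_form_wedge_1_2:
  fixes \<alpha> :: "'m::{t2_space, second_countable_topology} form"
  assumes "smooth_atlas \<A>" "is_form \<A> 1 \<alpha>" "is_form \<A> 2 \<beta>"
  shows "is_form \<A> 3 (\<alpha> \<^bold>\<and> \<beta>)"
proof (rule is_formI)
  note sup = assms(2,3)[THEN is_form_supported]
  note eval = wedge_1_2[OF sup]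
  show "supported \<A> 3 (\<alpha> \<^bold>\<and> \<beta>)" using supported_wedge[OF sup] by (simp add: numeral_eq_Suc)
  show "smooth_fun \<A> ((\<alpha> \<^bold>\<and> \<beta>) Xs)" for Xs
    using smooth_fun_wedge[OF assms(1) assms(2,3)[THEN is_form_smooth]] .
  note lin = form1_combination[OF assms(2)] form2_combination[OF assms(3)]
  fix Xs assume *: "length Xs = 3" "set Xs \<subseteq> vector_fields \<A>"
  then obtain X1 X2 X3 where Xs: "Xs = [X1, X2, X3]" and
    vf: "X1 \<in> vector_fields \<A>" "X2 \<in> vector_fields \<A>" "X3 \<in> vector_fields \<A>"
    by (auto simp: numeral_3_eq_3 length_Suc_conv)
  fix i x
  {
    fix Y Z and f g :: "'m \<Rightarrow> real"
    assume **: "i < (3::nat)" "Y \<in> vector_fields \<A>"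
      "Z \<in> vector_fields \<A>" "smooth_fun \<A> f" "smooth_fun \<A> g"
    from **(1) consider "i = 0" | "i = 1" | "i = 2" by linarith
    then show "(\<alpha> \<^bold>\<and> \<beta>) (Xs[i := (\<lambda>h x. f x * Y h x + g x * Z h x)]) x =
        complex_of_real (f x) * (\<alpha> \<^bold>\<and> \<beta>) (Xs[i := Y]) x + complex_of_real (g x) * (\<alpha> \<^bold>\<and> \<beta>) (Xs[i := Z]) x"
      by cases (simp_all add: Xs eval lin vf ** numeral_2_eq_2 algebra_simps)
  next
    fix j assume "i < j" "j < (3::nat)" "Xs ! i = Xs ! j"
    then consider "X1 = X2" | "X1 = X3" | "X2 = X3"
      by (auto simp: Xs numeral_3_eq_3 less_Suc_eq)
    \<comment> \<open>In each case two of the three terms cancel, and the third evaluates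
      \<open>\<beta>\<close> on a repeated argument.\<close>
    then show "(\<alpha> \<^bold>\<and> \<beta>) Xs x = 0"
      using form2_antisym[OF assms(1,3) vf(1,2), of x] form2_antisym[OF assms(1,3) vf(1,3), of x]
        form2_antisym[OF assms(1,3) vf(2,3), of x]
      by cases (simp_all add: Xs eval)
  }
qed


section \<open>The exterior derivative\<close>

text \<open>Turns the pair sum of the Koszul formula into nested sums, which simplification can
  unroll for lists of known length.\<close>

lemma sum_pairs_less: "(\<Sum>(i, j)\<in>{(i, j). i < j \<and> j < (n::nat)}. f i j) = (\<Sum>j<n. \<Sum>i<j. f i j)"
  by (subst sum.Sigma) (auto intro!: sum.reindex_bij_witness[of _ "\<lambda>(j, i). (i, j)" "\<lambda>(i, j). (j, i)"])

section \<open>The Koszul formula in low degree, support, and linearity of d\<close>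

lemma ext_d_1:
  assumes "X \<in> vector_fields \<A>" "Y \<in> vector_fields \<A>"
  shows "ext_d \<A> \<omega> [X, Y] x =
    derive_complex X (\<omega> [Y]) x - derive_complex Y (\<omega> [X]) x - \<omega> [lie_bracket X Y] x"
  using assms by (simp add: ext_d_def sum_pairs_less numeral_eq_Suc nths_Cons)

lemma ext_d_2:
  assumes "X \<in> vector_fields \<A>" "Y \<in> vector_fields \<A>" "Z \<in> vector_fields \<A>"
  shows "ext_d \<A> \<omega> [X, Y, Z] x =
    derive_complex X (\<omega> [Y, Z]) x - derive_complex Y (\<omega> [X, Z]) x + derive_complex Z (\<omega> [X, Y]) x
    - \<omega> [lie_bracket X Y, Z] x + \<omega> [lie_bracket X Z, Y] x - \<omega> [lie_bracket Y Z, X] x"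
  using assms by (simp add: ext_d_def sum_pairs_less numeral_eq_Suc nths_Cons)

lemma ext_d_3:
  assumes "X \<in> vector_fields \<A>" "Y \<in> vector_fields \<A>" "Z \<in> vector_fields \<A>" "W \<in> vector_fields \<A>"
  shows "ext_d \<A> \<omega> [X, Y, Z, W] x =
    derive_complex X (\<omega> [Y, Z, W]) x - derive_complex Y (\<omega> [X, Z, W]) x
    + derive_complex Z (\<omega> [X, Y, W]) x - derive_complex W (\<omega> [X, Y, Z]) x
    - \<omega> [lie_bracket X Y, Z, W] x + \<omega> [lie_bracket X Z, Y, W] x - \<omega> [lie_bracket X W, Y, Z] x
    - \<omega> [lie_bracket Y Z, X, W] x + \<omega> [lie_bracket Y W, X, Z] x - \<omega> [lie_bracket Z W, X, Y] x"
  using assms by (simp add: ext_d_def sum_pairs_less numeral_eq_Suc nths_Cons)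

text \<open>Omitting one entry, or replacing two entries by their bracket, shortens the list by
  exactly one.\<close>

lemma supported_ext_d:
  assumes "supported \<A> k \<omega>"
  shows "supported \<A> (Suc k) (ext_d \<A> \<omega>)"
  unfolding supported_def
proof (intro allI impI)
  fix Xs assume not: "\<not> (length Xs = Suc k \<and> set Xs \<subseteq> vector_fields \<A>)"
  show "ext_d \<A> \<omega> Xs = (\<lambda>_. 0)"
  proof (cases "set Xs \<subseteq> vector_fields \<A>")
    case True
    with not have len: "length Xs \<noteq> Suc k" by simp
    have "\<omega> (nths Xs (- {i})) = (\<lambda>_. 0)" if "i < length Xs" for i
    proof -
      have "{j. j < length Xs \<and> j \<in> - {i}} = {..<length Xs} - {i}" by auto
      then have "length (nths Xs (- {i})) = length Xs - 1" using that by (simp add: length_nths)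
      then show ?thesis using len that by (intro supported_length[OF assms]) auto
    qed
    moreover have "derive_complex X (\<lambda>_. 0) = (\<lambda>_. 0)" if "X \<in> set Xs" for X
      using derive_complex_const True that by blast
    moreover have "\<omega> (V # nths Xs (- {i, j})) = (\<lambda>_. 0)" if "i < j" "j < length Xs" for i j V
    proof -
      have "{m. m < length Xs \<and> m \<in> - {i, j}} = {..<length Xs} - {i, j}" by auto
      then have "length (nths Xs (- {i, j})) = length Xs - 2"
        using that by (simp add: length_nths card_Diff_subset)
      then show ?thesis using len that by (intro supported_length[OF assms]) auto
    qed
    ultimately show ?thesis using True by (simp add: ext_d_def sum_pairs_less)
  qed (simp add: ext_d_def fun_eq_iff)
qed

text \<open>Smooth coefficients matter here: vector fields are set to zero on non-smooth functions,
  so they need not be additive across such functions.\<close>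

lemma ext_d_add:
  assumes "smooth_atlas \<A>" "is_form \<A> k \<omega>" "is_form \<A> l \<eta>"
  shows "ext_d \<A> (\<omega> + \<eta>) = ext_d \<A> \<omega> + ext_d \<A> \<eta>"
proof (intro ext)
  fix Xs x
  have "derive_complex X (\<lambda>x. \<omega> Ys x + \<eta> Ys x) =
      (\<lambda>x. derive_complex X (\<omega> Ys) x + derive_complex X (\<eta> Ys) x)"
    if "X \<in> vector_fields \<A>" for X Ys
    using derive_complex_add[OF assms(1) that is_form_smooth[OF assms(2)] is_form_smooth[OF assms(3)]] .
  then have "set Xs \<subseteq> vector_fields \<A> \<Longrightarrow> i < length Xs \<Longrightarrow> derive_complex (Xs ! i) (\<lambda>x. \<omega> Ys x + \<eta> Ys x) x =
      derive_complex (Xs ! i) (\<omega> Ys) x + derive_complex (Xs ! i) (\<eta> Ys) x" for Ys i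
    using nth_mem by (metis subsetD)
  then show "ext_d \<A> (\<omega> + \<eta>) Xs x = (ext_d \<A> \<omega> + ext_d \<A> \<eta>) Xs x"
    by (simp add: ext_d_def plus_fun_def distrib_left sum.distrib sum_pairs_less)
qed

lemma ext_d_scale:
  assumes "smooth_atlas \<A>" "is_form \<A> k \<omega>"
  shows "ext_d \<A> (scale_form c \<omega>) = scale_form c (ext_d \<A> \<omega>)"
proof (intro ext)
  fix Xs x
  have "derive_complex X (\<lambda>x. c * \<omega> Ys x) = (\<lambda>x. c * derive_complex X (\<omega> Ys) x)"
    if "X \<in> vector_fields \<A>" for X Ys
    using derive_complex_cmult[OF assms(1) that is_form_smooth[OF assms(2)]] .
  then have "set Xs \<subseteq> vector_fields \<A> \<Longrightarrow> i < length Xs \<Longrightarrow> derive_complex (Xs ! i) (\<lambda>x. c * \<omega> Ys x) x =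
      c * derive_complex (Xs ! i) (\<omega> Ys) x" for Ys i
    using nth_mem by (metis subsetD)
  then show "ext_d \<A> (scale_form c \<omega>) Xs x = scale_form c (ext_d \<A> \<omega>) Xs x"
    by (simp add: ext_d_def scale_form_def distrib_left sum_distrib_left sum_pairs_less mult.left_commute)
qed

lemma smooth_fun_ext_d:
  assumes "smooth_atlas \<A>" "is_form \<A> k \<omega>"
  shows "smooth_fun \<A> (ext_d \<A> \<omega> Xs)"
proof (cases "set Xs \<subseteq> vector_fields \<A>")
  case True
  have "smooth_fun \<A> (\<lambda>x. \<Sum>i<length Xs. (-1) ^ i * derive_complex (Xs ! i) (\<omega> (nths Xs (- {i}))) x)"
    using True nth_mem
    by (intro smooth_fun_sum[OF assms(1)] smooth_fun_mult[OF assms(1)] smooth_fun_const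
        derive_complex_smooth[OF assms(1)] is_form_smooth[OF assms(2)]) auto
  moreover have "smooth_fun \<A> (\<lambda>x. \<Sum>j<length Xs. \<Sum>i<j. (-1) ^ (i + j) *
      \<omega> (lie_bracket (Xs ! i) (Xs ! j) # nths Xs (- {i, j})) x)"
    by (intro smooth_fun_sum[OF assms(1)] smooth_fun_mult[OF assms(1)] smooth_fun_const
        is_form_smooth[OF assms(2)])
  ultimately show ?thesis
    using True smooth_fun_add[OF assms(1)] by (simp add: ext_d_def sum_pairs_less)
next
  case False
  then have "ext_d \<A> \<omega> Xs = (\<lambda>_. 0)" by (simp add: ext_d_def)
  then show ?thesis by simp
qed

lemma form1_minus:
  assumes "is_form \<A> 1 \<omega>" "X \<in> vector_fields \<A>"
  shows "\<omega> [\<lambda>h x. - X h x] x = - \<omega> [X] x"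
  using form1_combination[OF assms(1,2,2), of "\<lambda>_. -1" "\<lambda>_. 0"] by simp

lemma form1_diff:
  assumes "is_form \<A> 1 \<omega>" "X \<in> vector_fields \<A>" "Y \<in> vector_fields \<A>"
  shows "\<omega> [\<lambda>h x. X h x - Y h x] x = \<omega> [X] x - \<omega> [Y] x"
  using form1_combination[OF assms, of "\<lambda>_. 1" "\<lambda>_. -1"] by simp

text \<open>Linearity over functions is the delicate point. The derivatives of the coefficients f
  and g appear once through the product rule and once through the bracket, with opposite
  signs.\<close>

lemma is_form_ext_d_1:
  fixes \<omega> :: "'m::{t2_space, second_countable_topology} form"
  assumes "smooth_atlas \<A>" "is_form \<A> 1 \<omega>"
  shows "is_form \<A> 2 (ext_d \<A> \<omega>)"
proof (rule is_form_2I)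
  show "supported \<A> 2 (ext_d \<A> \<omega>)"
    using supported_ext_d[OF is_form_supported[OF assms(2)]] by (simp add: numeral_2_eq_2)
  show "smooth_fun \<A> (ext_d \<A> \<omega> Xs)" for Xs by (rule smooth_fun_ext_d[OF assms])
  note sm = is_form_smooth[OF assms(2)]
  show "ext_d \<A> \<omega> [Y, X] x = - ext_d \<A> \<omega> [X, Y] x"
    if "X \<in> vector_fields \<A>" "Y \<in> vector_fields \<A>" for X Y x
    using that form1_minus[OF assms(2) lie_bracket_vector_field[OF assms(1) that]]
    by (simp add: ext_d_1 lie_bracket_swap[of Y X])
  fix X Y Z and f g :: "'m \<Rightarrow> real" and x
  assume vf: "X \<in> vector_fields \<A>" "Y \<in> vector_fields \<A>" "Z \<in> vector_fields \<A>"
    and fg: "smooth_fun \<A> f" "smooth_fun \<A> g"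
  let ?W = "\<lambda>h x. f x * Y h x + g x * Z h x"
  have W: "?W \<in> vector_fields \<A>" by (intro vector_field_combination assms vf fg)
  have YX: "lie_bracket Y X \<in> vector_fields \<A>" and ZX: "lie_bracket Z X \<in> vector_fields \<A>"
    by (intro lie_bracket_vector_field assms vf)+
  have sX: "smooth_fun \<A> (X f)" "smooth_fun \<A> (X g)"
    using vector_field_smooth[OF vf(1)] fg by auto
  \<comment> \<open>The bracket is split into two combinations of two vector fields each, the shape
    in which linearity of \<open>\<omega>\<close> is available.\<close>
  have "lie_bracket ?W X = (\<lambda>h x. (\<lambda>h x. f x * lie_bracket Y X h x + g x * lie_bracket Z X h x) h x
      - (\<lambda>h x. X f x * Y h x + X g x * Z h x) h x)"
    using lie_bracket_combination[OF assms(1) vf(2,3,1) fg] by (simp add: fun_eq_iff)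
  moreover have "\<omega> [\<dots>] x = \<omega> [\<lambda>h x. f x * lie_bracket Y X h x + g x * lie_bracket Z X h x] x
      - \<omega> [\<lambda>h x. X f x * Y h x + X g x * Z h x] x"
    by (rule form1_diff[OF assms(2)]; rule vector_field_combination; fact assms vf fg YX ZX sX)
  ultimately have br: "\<omega> [lie_bracket ?W X] x =
      f x * \<omega> [lie_bracket Y X] x + g x * \<omega> [lie_bracket Z X] x - X f x * \<omega> [Y] x - X g x * \<omega> [Z] x"
    by (simp add: form1_combination[OF assms(2)] vf fg YX ZX sX)
  have der: "derive_complex X (\<omega> [?W]) x =
      f x * derive_complex X (\<omega> [Y]) x + X f x * \<omega> [Y] x +
      (g x * derive_complex X (\<omega> [Z]) x + X g x * \<omega> [Z] x)"
    by (simp add: form1_combination[OF assms(2) vf(2,3) fg] derive_complex_add[OF assms(1) vf(1)]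
        derive_complex_mult[OF assms(1) vf(1)] smooth_fun_mult[OF assms(1)] smooth_fun_of_real[OF assms(1)]
        fg sm derive_complex_of_real[OF vf(1)])
  show "ext_d \<A> \<omega> [?W, X] x =
        complex_of_real (f x) * ext_d \<A> \<omega> [Y, X] x + complex_of_real (g x) * ext_d \<A> \<omega> [Z, X] x"
    by (simp add: ext_d_1 W vf der br derive_complex_combination algebra_simps)
qed (rule assms)

text \<open>The commutators of iterated derivatives cancel against derivatives along brackets. What
  remains is \<open>\<omega>\<close> on three double brackets, whose sum vanishes by the Jacobi
  identity.\<close>

lemma ext_d_ext_d_1:
  assumes "smooth_atlas \<A>" "is_form \<A> 1 \<omega>"
  shows "ext_d \<A> (ext_d \<A> \<omega>) = 0"
proof (rule supported_eqI)
  show "supported \<A> 3 (ext_d \<A> (ext_d \<A> \<omega>))"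
    using supported_ext_d[OF supported_ext_d[OF is_form_supported[OF assms(2)]]]
    by (simp add: numeral_eq_Suc)
  show "supported \<A> 3 0" by (simp add: supported_def fun_eq_iff)
  note sm = is_form_smooth[OF assms(2)]
  fix Xs x assume "length Xs = 3" "set Xs \<subseteq> vector_fields \<A>"
  then obtain X Y Z where Xs: "Xs = [X, Y, Z]" and
    vf: "X \<in> vector_fields \<A>" "Y \<in> vector_fields \<A>" "Z \<in> vector_fields \<A>"
    by (auto simp: numeral_3_eq_3 length_Suc_conv)
  have lb: "lie_bracket U V \<in> vector_fields \<A>" if "U \<in> vector_fields \<A>" "V \<in> vector_fields \<A>" for U V
    by (rule lie_bracket_vector_field[OF assms(1) that])
  have d1: "ext_d \<A> \<omega> [U, V] =
    (\<lambda>x. derive_complex U (\<omega> [V]) x - derive_complex V (\<omega> [U]) x - \<omega> [lie_bracket U V] x)"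
    if "U \<in> vector_fields \<A>" "V \<in> vector_fields \<A>" for U V
    using ext_d_1[OF that] by (simp add: fun_eq_iff)
  have "lie_bracket (lie_bracket X Y) Z =
      (\<lambda>h x. lie_bracket (lie_bracket X Z) Y h x - lie_bracket (lie_bracket Y Z) X h x)"
    using jacobi[OF vf] by (simp add: fun_eq_iff)
  then have jac: "\<omega> [lie_bracket (lie_bracket X Y) Z] x =
      \<omega> [lie_bracket (lie_bracket X Z) Y] x - \<omega> [lie_bracket (lie_bracket Y Z) X] x"
    using form1_diff[OF assms(2) lb[OF lb[OF vf(1,3)] vf(2)] lb[OF lb[OF vf(2,3)] vf(1)]] by simp
  have der: "derive_complex U (\<lambda>x. derive_complex V (\<omega> [W]) x - derive_complex W (\<omega> [V]) x - \<omega> [lie_bracket V W] x) x =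
      derive_complex U (derive_complex V (\<omega> [W])) x - derive_complex U (derive_complex W (\<omega> [V])) x -
        derive_complex U (\<omega> [lie_bracket V W]) x"
    if "U \<in> vector_fields \<A>" "V \<in> vector_fields \<A>" "W \<in> vector_fields \<A>" for U V W
    using that
    by (simp add: derive_complex_diff[OF assms(1) that(1)] smooth_fun_diff[OF assms(1)] sm
        derive_complex_smooth[OF assms(1)])
  show "ext_d \<A> (ext_d \<A> \<omega>) Xs x = 0 Xs x"
    by (simp add: Xs ext_d_2 d1 vf lb der derive_complex_lie_bracket jac)
qed

section \<open>The graded Leibniz rule, by evaluation on explicit vector fields\<close>

lemma ext_d_wedge_1_1:
  assumes "smooth_atlas \<A>" "is_form \<A> 1 \<alpha>" "is_form \<A> 1 \<beta>"
  shows "ext_d \<A> (\<alpha> \<^bold>\<and> \<beta>) = ext_d \<A> \<alpha> \<^bold>\<and> \<beta> - \<alpha> \<^bold>\<and> ext_d \<A> \<beta>"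
proof (rule supported_eqI)
  note sup = assms(2,3)[THEN is_form_supported]
  have dsup: "supported \<A> 2 (ext_d \<A> \<alpha>)" "supported \<A> 2 (ext_d \<A> \<beta>)"
    using sup[THEN supported_ext_d] by (simp_all add: numeral_2_eq_2)
  show "supported \<A> 3 (ext_d \<A> (\<alpha> \<^bold>\<and> \<beta>))"
    using supported_ext_d[OF supported_wedge[OF sup]] by (simp add: numeral_eq_Suc)
  show "supported \<A> 3 (ext_d \<A> \<alpha> \<^bold>\<and> \<beta> - \<alpha> \<^bold>\<and> ext_d \<A> \<beta>)"
    using supported_wedge[OF dsup(1) sup(2)] supported_wedge[OF sup(1) dsup(2)]
    by (intro supported_diff) (simp_all add: numeral_eq_Suc)
  note sm = assms(2,3)[THEN is_form_smooth]
  fix Xs x assume "length Xs = 3" "set Xs \<subseteq> vector_fields \<A>"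
  then obtain X Y Z where Xs: "Xs = [X, Y, Z]" and
    vf: "X \<in> vector_fields \<A>" "Y \<in> vector_fields \<A>" "Z \<in> vector_fields \<A>"
    by (auto simp: numeral_3_eq_3 length_Suc_conv)
  have w: "(\<alpha> \<^bold>\<and> \<beta>) [U, V] = (\<lambda>x. \<alpha> [U] x * \<beta> [V] x - \<alpha> [V] x * \<beta> [U] x)" for U V
    using wedge_1_1[OF sup] by (simp add: fun_eq_iff)
  have der: "derive_complex U (\<lambda>x. \<alpha> [V] x * \<beta> [W] x - \<alpha> [W] x * \<beta> [V] x) x
      = \<alpha> [V] x * derive_complex U (\<beta> [W]) x + derive_complex U (\<alpha> [V]) x * \<beta> [W] x -
       (\<alpha> [W] x * derive_complex U (\<beta> [V]) x + derive_complex U (\<alpha> [W]) x * \<beta> [V] x)"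
    if "U \<in> vector_fields \<A>" for U V W
    by (simp add: derive_complex_diff[OF assms(1) that] derive_complex_mult[OF assms(1) that]
        smooth_fun_mult[OF assms(1)] sm)
  show "ext_d \<A> (\<alpha> \<^bold>\<and> \<beta>) Xs x = (ext_d \<A> \<alpha> \<^bold>\<and> \<beta> - \<alpha> \<^bold>\<and> ext_d \<A> \<beta>) Xs x"
    unfolding Xs minus_apply wedge_1_2[OF sup(1) dsup(2)] wedge_2_1[OF dsup(1) sup(2)]
    by (simp add: ext_d_1 ext_d_2 w vf der algebra_simps)
qed

lemma ext_d_wedge_1_2:
  assumes "smooth_atlas \<A>" "is_form \<A> 1 \<alpha>" "is_form \<A> 2 \<beta>"
  shows "ext_d \<A> (\<alpha> \<^bold>\<and> \<beta>) = ext_d \<A> \<alpha> \<^bold>\<and> \<beta> - \<alpha> \<^bold>\<and> ext_d \<A> \<beta>"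
proof (rule supported_eqI)
  note sup = assms(2,3)[THEN is_form_supported]
  have dsup: "supported \<A> 2 (ext_d \<A> \<alpha>)" "supported \<A> 3 (ext_d \<A> \<beta>)"
    using sup[THEN supported_ext_d] by (simp_all add: numeral_2_eq_2 numeral_3_eq_3)
  show "supported \<A> 4 (ext_d \<A> (\<alpha> \<^bold>\<and> \<beta>))"
    using supported_ext_d[OF supported_wedge[OF sup]] by (simp add: numeral_eq_Suc)
  show "supported \<A> 4 (ext_d \<A> \<alpha> \<^bold>\<and> \<beta> - \<alpha> \<^bold>\<and> ext_d \<A> \<beta>)"
    using supported_wedge[OF dsup(1) sup(2)] supported_wedge[OF sup(1) dsup(2)]
    by (intro supported_diff) (simp_all add: numeral_eq_Suc)
  note sm = is_form_smooth[OF assms(2)] is_form_smooth[OF assms(3)]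
  fix Xs x assume "length Xs = 4" "set Xs \<subseteq> vector_fields \<A>"
  then obtain X Y Z W where Xs: "Xs = [X, Y, Z, W]" and
    vf: "X \<in> vector_fields \<A>" "Y \<in> vector_fields \<A>" "Z \<in> vector_fields \<A>" "W \<in> vector_fields \<A>"
    by (auto simp: numeral_eq_Suc length_Suc_conv)
  have w: "(\<alpha> \<^bold>\<and> \<beta>) [T, U, V] =
      (\<lambda>x. \<alpha> [T] x * \<beta> [U, V] x - \<alpha> [U] x * \<beta> [T, V] x + \<alpha> [V] x * \<beta> [T, U] x)" for T U V
    using wedge_1_2[OF sup] by (simp add: fun_eq_iff)
  have der: "derive_complex S (\<lambda>x. \<alpha> [T] x * \<beta> [U, V] x - \<alpha> [U] x * \<beta> [T, V] x + \<alpha> [V] x * \<beta> [T, U] x) x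
      = \<alpha> [T] x * derive_complex S (\<beta> [U, V]) x + derive_complex S (\<alpha> [T]) x * \<beta> [U, V] x -
       (\<alpha> [U] x * derive_complex S (\<beta> [T, V]) x + derive_complex S (\<alpha> [U]) x * \<beta> [T, V] x) +
       (\<alpha> [V] x * derive_complex S (\<beta> [T, U]) x + derive_complex S (\<alpha> [V]) x * \<beta> [T, U] x)"
    if "S \<in> vector_fields \<A>" for S T U V
    by (simp add: derive_complex_add[OF assms(1) that] derive_complex_diff[OF assms(1) that]
        derive_complex_mult[OF assms(1) that]
        smooth_fun_mult[OF assms(1)] smooth_fun_diff[OF assms(1)] sm)
  show "ext_d \<A> (\<alpha> \<^bold>\<and> \<beta>) Xs x = (ext_d \<A> \<alpha> \<^bold>\<and> \<beta> - \<alpha> \<^bold>\<and> ext_d \<A> \<beta>) Xs x"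
    unfolding Xs minus_apply wedge_1_3[OF sup(1) dsup(2)] wedge_2_2[OF dsup(1) sup(2)]
    by (simp only: ext_d_1 ext_d_2 ext_d_3 w vf der) (simp add: algebra_simps)
qed


section \<open>Gauge covariance of the curvature\<close>

text \<open>Evaluation at vector fields and a point replaces matrices of forms by complex matrices,
  so that gauge covariance becomes ordinary matrix algebra.\<close>

definition eval_matrix :: "'m form^'k^'l \<Rightarrow> 'm vfield list \<Rightarrow> 'm \<Rightarrow> complex^'k^'l" where
  "eval_matrix W Xs x = (\<chi> i j. (W $ i $ j) Xs x)"

definition derive_matrix :: "'m vfield \<Rightarrow> ('m \<Rightarrow> complex^'k^'l) \<Rightarrow> 'm \<Rightarrow> complex^'k^'l" where
  "derive_matrix X f x = (\<chi> i j. derive_complex X (\<lambda>y. f y $ i $ j) x)"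

definition smooth_matrix :: "('m, 'e::euclidean_space) atlas \<Rightarrow> ('m \<Rightarrow> complex^'k^'l) \<Rightarrow> bool" where
  "smooth_matrix \<A> f \<longleftrightarrow> (\<forall>i j. smooth_fun \<A> (\<lambda>x. f x $ i $ j))"

definition adjoint_matrix :: "complex^'n^'n \<Rightarrow> complex^'n^'n" where
  "adjoint_matrix h = (\<chi> i j. cnj (h $ j $ i))"

lemma matrix_mult_minus_left: "(- A) ** B = - (A ** (B :: complex^'k^'n))"
  by (simp add: vec_eq_iff matrix_matrix_mult_def sum_negf)

lemma matrix_mult_minus_right: "A ** (- B) = - (A ** (B :: complex^'k^'n))"
  by (simp add: vec_eq_iff matrix_matrix_mult_def sum_negf)

lemma matrix_mult_diff_left: "(A - A') ** B = A ** B - A' ** (B :: complex^'k^'n)"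
  by (simp add: vec_eq_iff matrix_matrix_mult_def sum_subtractf algebra_simps)

lemma matrix_mult_diff_right: "A ** (B - B') = A ** B - A ** (B' :: complex^'k^'n)"
  by (simp add: vec_eq_iff matrix_matrix_mult_def sum_subtractf algebra_simps)

lemma matrix_add_rdistrib: "(A + A') ** B = A ** B + A' ** (B :: complex^'k^'n)"
  by (simp add: vec_eq_iff matrix_matrix_mult_def sum.distrib algebra_simps)

lemma smooth_matrix_mult:
  assumes "smooth_atlas \<A>" "smooth_matrix \<A> f" "smooth_matrix \<A> g"
  shows "smooth_matrix \<A> (\<lambda>x. f x ** g x)"
proof -
  have "smooth_fun \<A> (\<lambda>x. \<Sum>k\<in>UNIV. f x $ i $ k * g x $ k $ j)" for i j
    using assms(2,3) unfolding smooth_matrix_def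
    by (intro smooth_fun_sum[OF assms(1)] smooth_fun_mult[OF assms(1)]) auto
  then show ?thesis by (simp add: smooth_matrix_def matrix_matrix_mult_def)
qed

lemma derive_matrix_mult:
  assumes "smooth_atlas \<A>" "X \<in> vector_fields \<A>" "smooth_matrix \<A> f" "smooth_matrix \<A> g"
  shows "derive_matrix X (\<lambda>x. f x ** g x) x = f x ** derive_matrix X g x + derive_matrix X f x ** g x"
proof -
  have sm: "smooth_fun \<A> (\<lambda>x. f x $ i $ j)" "smooth_fun \<A> (\<lambda>x. g x $ i' $ j')" for i j i' j'
    using assms(3,4) by (auto simp: smooth_matrix_def)
  show ?thesis
    by (simp add: derive_matrix_def matrix_matrix_mult_def vec_eq_iff derive_complex_sum[OF assms(1,2)]
        smooth_fun_mult[OF assms(1)] sm derive_complex_mult[OF assms(1,2)] sum.distrib)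
qed

lemma derive_matrix_add:
  assumes "smooth_atlas \<A>" "X \<in> vector_fields \<A>" "smooth_matrix \<A> f" "smooth_matrix \<A> g"
  shows "derive_matrix X (\<lambda>x. f x + g x) x = derive_matrix X f x + derive_matrix X g x"
proof -
  have sm: "smooth_fun \<A> (\<lambda>x. f x $ i $ j)" "smooth_fun \<A> (\<lambda>x. g x $ i' $ j')" for i j i' j'
    using assms(3,4) by (auto simp: smooth_matrix_def)
  show ?thesis
    by (simp add: derive_matrix_def vec_eq_iff sm derive_complex_add[OF assms(1,2)])
qed

lemma derive_matrix_const:
  assumes "X \<in> vector_fields \<A>"
  shows "derive_matrix X (\<lambda>_. c) x = 0"
  by (simp add: derive_matrix_def vec_eq_iff derive_complex_const[OF assms])

lemma smooth_derive_matrix: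
  assumes "smooth_atlas \<A>" "X \<in> vector_fields \<A>" "smooth_matrix \<A> f"
  shows "smooth_matrix \<A> (derive_matrix X f)"
  using assms(3) derive_complex_smooth[OF assms(1,2)] by (simp add: smooth_matrix_def derive_matrix_def)

lemma derive_matrix_lie_bracket:
  "derive_matrix (lie_bracket X Y) f x =
    derive_matrix X (derive_matrix Y f) x - derive_matrix Y (derive_matrix X f) x"
  by (simp add: derive_matrix_def vec_eq_iff derive_complex_lie_bracket)

lemma sum_form_apply: "(\<Sum>k\<in>I. f k :: 'm form) Xs x = (\<Sum>k\<in>I. f k Xs x)"
  by (induction I rule: infinite_finite_induct) simp_all

text \<open>The structure equation: on two vector fields, W \<and> W becomes the commutator of the
  two values of W.\<close>

lemma eval_curvature:
  assumes "\<And>i j. supported \<A> 1 (W $ i $ j)" "X \<in> vector_fields \<A>" "Y \<in> vector_fields \<A>"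
  shows "eval_matrix (curvature \<A> W) [X, Y] x =
    derive_matrix X (eval_matrix W [Y]) x - derive_matrix Y (eval_matrix W [X]) x
    - eval_matrix W [lie_bracket X Y] x
    + eval_matrix W [X] x ** eval_matrix W [Y] x - eval_matrix W [Y] x ** eval_matrix W [X] x"
  by (simp add: vec_eq_iff curvature_def mext_d_def mwedge_def eval_matrix_def derive_matrix_def
        matrix_matrix_mult_def ext_d_1 assms sum_form_apply wedge_1_1[OF assms(1,1)] sum_subtractf mult.commute
        algebra_simps)

lemma zero_form_wedge_1: "(zero_form f \<^bold>\<and> \<omega>) [X] x = f x * \<omega> [X] x"
  by (simp add: wedge_Cons wedge_Nil zero_form_def)

lemma wedge_zero_form_1: "(\<omega> \<^bold>\<and> zero_form f) [X] x = \<omega> [X] x * f x"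
  by (simp add: wedge_Cons wedge_Nil zero_form_def)

lemma ext_d_zero_form:
  assumes "X \<in> vector_fields \<A>"
  shows "ext_d \<A> (zero_form f) [X] x = derive_complex X f x"
  using assms by (simp add: ext_d_def sum_pairs_less nths_Cons zero_form_def)

lemma eval_gauge_transform:
  assumes "X \<in> vector_fields \<A>"
  shows "eval_matrix (gauge_transform \<A> h W) [X] x =
    h x ** eval_matrix W [X] x ** adjoint_matrix (h x)
    + h x ** derive_matrix X (\<lambda>y. adjoint_matrix (h y)) x"
  by (simp add: vec_eq_iff gauge_transform_def Let_def eval_matrix_def mwedge_def mext_d_def sum_form_apply
        zero_form_wedge_1 wedge_zero_form_1 ext_d_zero_form[OF assms] matrix_matrix_mult_def adjoint_matrix_def
        derive_matrix_def)

lemma smooth_adjoint_matrix: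
  assumes "smooth_atlas \<A>" "smooth_matrix \<A> h"
  shows "smooth_matrix \<A> (\<lambda>x. adjoint_matrix (h x))"
  using assms(2) smooth_fun_cnj[OF assms(1)] by (simp add: smooth_matrix_def adjoint_matrix_def)

text \<open>Two groups of terms cancel, with k the inverse of h: second derivatives of k against its
  derivative along the bracket, and products of first derivatives through (U k) h = - k (U
  h).\<close>

lemma curvature_gauge_covariant:
  assumes "smooth_atlas \<A>" and smooth_h: "smooth_matrix \<A> h"
    and unitary: "\<And>x. h x ** adjoint_matrix (h x) = mat 1"
    and forms: "\<And>i j. is_form \<A> 1 (W $ i $ j)" "\<And>i j. is_form \<A> 1 (W' $ i $ j)"
    and W': "W' = gauge_transform \<A> h W"
    and vf: "X \<in> vector_fields \<A>" "Y \<in> vector_fields \<A>"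
  shows "eval_matrix (curvature \<A> W') [X, Y] x =
    h x ** eval_matrix (curvature \<A> W) [X, Y] x ** adjoint_matrix (h x)"
proof -
  define k where "k = (\<lambda>x. adjoint_matrix (h x))"
  have smooth_k: "smooth_matrix \<A> k"
    unfolding k_def by (rule smooth_adjoint_matrix[OF assms(1) smooth_h])
  have smooth_W: "smooth_matrix \<A> (eval_matrix W Xs)" for Xs
    using forms(1) is_form_smooth by (simp add: smooth_matrix_def eval_matrix_def) blast
  note sm = smooth_h smooth_k smooth_W smooth_matrix_mult[OF assms(1)] smooth_derive_matrix[OF assms(1)]
  have hk: "h x ** k x = mat 1" and kh: "k x ** h x = mat 1" for x
    using unitary matrix_left_right_inverse unfolding k_def by blast+
  \<comment> \<open>The derivative of k h = 1.\<close>
  have dkh: "derive_matrix U k x ** h x = - (k x ** derive_matrix U h x)" if "U \<in> vector_fields \<A>" for U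
    using derive_matrix_mult[OF assms(1) that smooth_k smooth_h, of x]
      derive_matrix_const[OF that, of "mat 1 :: complex^3^3" x]
    by (simp add: kh eq_neg_iff_add_eq_0 add.commute)
  \<comment> \<open>For products associated to the right, these rules remove adjacent inverse pairs
    and every derivative of k standing before h.\<close>
  have cancel: "h x ** (k x ** Z) = Z" "k x ** (h x ** Z) = Z"
    "U \<in> vector_fields \<A> \<Longrightarrow> derive_matrix U k x ** (h x ** Z) = - (k x ** (derive_matrix U h x ** Z))"
    for U and Z :: "complex^3^3"
    by (simp_all add: matrix_mul_assoc hk kh dkh matrix_mult_minus_left)
  have ev: "eval_matrix W' [U] = (\<lambda>y. (h y ** eval_matrix W [U] y) ** k y + h y ** derive_matrix U k y)"
    if "U \<in> vector_fields \<A>" for U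
    using eval_gauge_transform[OF that] by (simp add: fun_eq_iff W' k_def)
  have dev: "derive_matrix U (eval_matrix W' [V]) x =
      (h x ** eval_matrix W [V] x) ** derive_matrix U k x
      + (h x ** derive_matrix U (eval_matrix W [V]) x + derive_matrix U h x ** eval_matrix W [V] x) ** k x
      + (h x ** derive_matrix U (derive_matrix V k) x + derive_matrix U h x ** derive_matrix V k x)"
    if "U \<in> vector_fields \<A>" "V \<in> vector_fields \<A>" for U V
    by (simp add: ev[OF that(2)] derive_matrix_add[OF assms(1) that(1)] derive_matrix_mult[OF assms(1) that(1)]
        sm that)
  note lb = lie_bracket_vector_field[OF assms(1) vf]
  show ?thesis
    unfolding eval_curvature[OF is_form_supported[OF forms(2)] vf]
      eval_curvature[OF is_form_supported[OF forms(1)] vf]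
      dev[OF vf] dev[OF vf(2,1)]
    unfolding ev[OF vf(1)] ev[OF vf(2)] ev[OF lb] derive_matrix_lie_bracket
      k_def[symmetric, THEN fun_cong]
    by (simp add: matrix_mul_assoc[symmetric] matrix_add_ldistrib matrix_add_rdistrib
        matrix_mult_diff_left matrix_mult_diff_right matrix_mult_minus_left matrix_mult_minus_right
        cancel vf)
qed


section \<open>The Cartan curvature\<close>

text \<open>The covariant derivative for the action of the full connection. The factor 3 is 1 -
  (-2): the upper left block contributes a \<and> \<Psi>, and the lower right entry contributes
  \<Psi> \<and> (-2a) = 2 a \<and> \<Psi>. Sums are written out so that the closure rules of
  \<open>built_from_fields\<close> apply directly.\<close>

definition frame_derivative ::
  "('m, 'e::euclidean_space) atlas \<Rightarrow> 'm form^2^2 \<Rightarrow> 'm form \<Rightarrow> 'm form^2 \<Rightarrow> 2 \<Rightarrow> 'm form" where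
  "frame_derivative \<A> A a \<Psi> i =
     ext_d \<A> (\<Psi> $ i) + (A $ i $ 1 \<^bold>\<and> \<Psi> $ 1 + A $ i $ 2 \<^bold>\<and> \<Psi> $ 2) + scale_form 3 (a \<^bold>\<and> \<Psi> $ i)"

definition frame_3_form :: "('m, 'e::euclidean_space) atlas \<Rightarrow> 'm integrand" where
  "frame_3_form \<A> A a \<Psi> =
     conj_form (\<Psi> $ 1) \<^bold>\<and> frame_derivative \<A> A a \<Psi> 1 + conj_form (\<Psi> $ 2) \<^bold>\<and> frame_derivative \<A> A a \<Psi> 2"

lemma curvature_nth:
  "curvature \<A> W $ i $ j = ext_d \<A> (W $ i $ j) + (\<Sum>k\<in>UNIV. W $ i $ k \<^bold>\<and> W $ k $ j)"
  by (simp add: curvature_def mext_d_def mwedge_def)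

lemma form_minus_eq_scale: "- \<omega> = scale_form (-1) (\<omega> :: 'm form)"
  by (simp add: scale_form_def fun_eq_iff)

text \<open>One configuration is fixed, so that the invariance proof can interpret the locale for
  the original and for the transformed fields.\<close>

locale field_configuration =
  fixes \<A> :: "('m::{t2_space, second_countable_topology}, 'e::euclidean_space) atlas"
    and A :: "'m form^2^2" and a :: "'m form" and \<Psi> :: "'m form^2"
  assumes atlas: "smooth_atlas \<A>" and config: "field_config \<A> A a \<Psi>"
begin

abbreviation "F \<equiv> curvature \<A> A"
abbreviation "C \<equiv> cartan_connection A a \<Psi>"
abbreviation "D \<equiv> frame_derivative \<A> A a \<Psi>"

lemma form_A: "is_form \<A> 1 (A $ i $ j)" and form_a: "is_form \<A> 1 a" and form_\<Psi>: "is_form \<A> 1 (\<Psi> $ i)"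
  and trace_A: "A $ 2 $ 2 = - (A $ 1 $ 1)"
proof -
  have "A $ 1 $ 1 + A $ 2 $ 2 = 0"
    using config by (simp add: field_config_def is_su2_connection_def trace_def sum_2)
  then show "A $ 2 $ 2 = - (A $ 1 $ 1)" by (metis add.inverse_unique)
qed (use config in \<open>auto simp: field_config_def is_su2_connection_def is_u1_connection_def is_frame_def\<close>)

lemma form_conj_\<Psi>: "is_form \<A> 1 (conj_form (\<Psi> $ i))"
  by (rule is_form_conj[OF atlas form_\<Psi>])

lemmas sup_1 = form_A[THEN is_form_supported] form_a[THEN is_form_supported]
  form_\<Psi>[THEN is_form_supported] form_conj_\<Psi>[THEN is_form_supported]

lemma ext_d_minus: "is_form \<A> k \<omega> \<Longrightarrow> ext_d \<A> (- \<omega>) = - ext_d \<A> \<omega>"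
  unfolding form_minus_eq_scale by (rule ext_d_scale[OF atlas])

lemma supported_F: "supported \<A> 2 (F $ i $ j)"
proof -
  have "supported \<A> 2 (ext_d \<A> (A $ i $ j))"
    by (intro is_form_supported is_form_ext_d_1 atlas form_A)
  moreover have "supported \<A> 2 (A $ i $ k \<^bold>\<and> A $ k $ j)" for k
    by (intro is_form_supported is_form_wedge_1_1 atlas form_A)
  ultimately show ?thesis by (simp add: curvature_nth sum_2 supported_add)
qed

lemma supported_da: "supported \<A> 2 (ext_d \<A> a)"
  by (intro is_form_supported is_form_ext_d_1 atlas form_a)

lemma form_D: "is_form \<A> 2 (D i)"
  unfolding frame_derivative_def
  by (intro is_form_add is_form_ext_d_1 is_form_wedge_1_1 is_form_scale atlas form_A form_a form_\<Psi>)

lemma wedge_A_A: "A $ i $ j \<^bold>\<and> A $ i $ j = 0"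
  by (rule wedge_self[OF sup_1(1)]) simp

text \<open>The version with a trailing \<open>\<omega>\<close>, here and in the next rule, serves
  products associated to the right.\<close>

lemma wedge_a_a: "a \<^bold>\<and> a = 0" "a \<^bold>\<and> (a \<^bold>\<and> \<omega>) = 0"
proof -
  show "a \<^bold>\<and> a = 0" by (rule wedge_self[OF sup_1(2)]) simp
  then show "a \<^bold>\<and> (a \<^bold>\<and> \<omega>) = 0"
    using wedge_zero_left[of \<omega>] by (simp add: wedge_assoc[symmetric] zero_fun_def)
qed

lemma wedge_A_a: "A $ i $ j \<^bold>\<and> a = - (a \<^bold>\<and> A $ i $ j)"
  "A $ i $ j \<^bold>\<and> (a \<^bold>\<and> \<omega>) = - (a \<^bold>\<and> (A $ i $ j \<^bold>\<and> \<omega>))"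
proof -
  show "A $ i $ j \<^bold>\<and> a = - (a \<^bold>\<and> A $ i $ j)" by (rule wedge_anticommute[OF sup_1(1,2)]) simp
  then show "A $ i $ j \<^bold>\<and> (a \<^bold>\<and> \<omega>) = - (a \<^bold>\<and> (A $ i $ j \<^bold>\<and> \<omega>))"
    by (simp add: wedge_assoc[symmetric] wedge_minus_left)
qed

lemma wedge_\<Psi>_a: "\<Psi> $ i \<^bold>\<and> a = - (a \<^bold>\<and> \<Psi> $ i)"
  by (rule wedge_anticommute[OF sup_1(3,2)]) simp

lemma wedge_a_conj_\<Psi>: "a \<^bold>\<and> conj_form (\<Psi> $ i) = - (conj_form (\<Psi> $ i) \<^bold>\<and> a)"
  by (rule wedge_anticommute[OF sup_1(2,4)]) simp

text \<open>A \<and> A is traceless because A consists of 1-forms: the diagonal squares vanish and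
  the two mixed products cancel. This removes the term in da and tr F from the squared upper
  block.\<close>

lemma trace_F: "F $ 2 $ 2 = - (F $ 1 $ 1)"
proof -
  have "A $ 2 $ 1 \<^bold>\<and> A $ 1 $ 2 = - (A $ 1 $ 2 \<^bold>\<and> A $ 2 $ 1)"
    by (rule wedge_anticommute[OF sup_1(1,1)]) simp
  then show ?thesis
    by (simp add: curvature_nth sum_2 trace_A ext_d_minus[OF form_A] wedge_minus_left wedge_minus_right
        wedge_A_A)
qed

lemmas wedge_linear = wedge_add_left wedge_add_right wedge_minus_left wedge_minus_right
  wedge_scale_left wedge_scale_right wedge_diff_left wedge_diff_right

lemma form_cartan: "is_form \<A> 1 (C $ i $ j)"
proof -
  have "is_form \<A> 1 (- conj_form (\<Psi> $ i))" for i
    unfolding form_minus_eq_scale by (rule is_form_scale[OF atlas form_conj_\<Psi>])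
  then show ?thesis
    using exhaust_3[of i] exhaust_3[of j]
    by (auto simp: cartan_connection_def is_form_add[OF atlas] is_form_scale[OF atlas] form_A form_a form_\<Psi>
        simp del: One_nat_def)
qed

section \<open>Blocks of the Cartan curvature\<close>

text \<open>The abelian part enters only through da, since a \<and> a = 0 and A \<and> a + a \<and>
  A = 0.\<close>

lemma cartan_curvature_22:
  "curvature \<A> C $ 1 $ 1 = F $ 1 $ 1 + ext_d \<A> a - \<Psi> $ 1 \<^bold>\<and> conj_form (\<Psi> $ 1)"
  "curvature \<A> C $ 1 $ 2 = F $ 1 $ 2 - \<Psi> $ 1 \<^bold>\<and> conj_form (\<Psi> $ 2)"
  "curvature \<A> C $ 2 $ 1 = F $ 2 $ 1 - \<Psi> $ 2 \<^bold>\<and> conj_form (\<Psi> $ 1)"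
  "curvature \<A> C $ 2 $ 2 = F $ 2 $ 2 + ext_d \<A> a - \<Psi> $ 2 \<^bold>\<and> conj_form (\<Psi> $ 2)"
  by (simp_all add: curvature_nth sum_2 sum_3 cartan_connection_def ext_d_add[OF atlas form_A form_a]
      wedge_linear wedge_a_a wedge_A_a)

lemma cartan_curvature_33:
  "curvature \<A> C $ 3 $ 3 = - (scale_form 2 (ext_d \<A> a) + dagger_psi \<Psi>)"
  by (simp add: curvature_nth sum_2 sum_3 cartan_connection_def ext_d_scale[OF atlas form_a]
      wedge_linear wedge_a_a dagger_psi_def)
    (simp add: fun_eq_iff scale_form_def)

lemma cartan_curvature_i3:
  "curvature \<A> C $ 1 $ 3 = D 1" "curvature \<A> C $ 2 $ 3 = D 2"
  by (simp_all add: curvature_nth sum_3 cartan_connection_def frame_derivative_def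
      wedge_linear wedge_\<Psi>_a) (simp_all add: fun_eq_iff scale_form_def)

text \<open>The 3 again combines 1 from the upper left block with 2 from the entry -2a, after a is
  moved to the right of the conjugate frame. This ordering is the one produced by differentiating
  \<open>frame_3_form\<close>.\<close>

lemma cartan_curvature_3i:
  "curvature \<A> C $ 3 $ 1 = - (ext_d \<A> (conj_form (\<Psi> $ 1)) + conj_form (\<Psi> $ 1) \<^bold>\<and> A $ 1 $ 1
     + conj_form (\<Psi> $ 2) \<^bold>\<and> A $ 2 $ 1 + scale_form 3 (conj_form (\<Psi> $ 1) \<^bold>\<and> a))"
  "curvature \<A> C $ 3 $ 2 = - (ext_d \<A> (conj_form (\<Psi> $ 2)) + conj_form (\<Psi> $ 1) \<^bold>\<and> A $ 1 $ 2
     + conj_form (\<Psi> $ 2) \<^bold>\<and> A $ 2 $ 2 + scale_form 3 (conj_form (\<Psi> $ 2) \<^bold>\<and> a))"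
  by (simp_all add: curvature_nth sum_3 cartan_connection_def ext_d_minus[OF form_conj_\<Psi>]
      wedge_linear wedge_a_conj_\<Psi>) (simp_all add: fun_eq_iff scale_form_def)

lemma supported_cartan_curvature: "supported \<A> 2 (curvature \<A> C $ i $ j)"
proof -
  have "supported \<A> 2 (ext_d \<A> (C $ i $ j))"
    by (intro is_form_supported is_form_ext_d_1 atlas form_cartan)
  moreover have "supported \<A> 2 (C $ i $ k \<^bold>\<and> C $ k $ j)" for k
    by (intro is_form_supported is_form_wedge_1_1 atlas form_cartan)
  ultimately show ?thesis by (simp add: curvature_nth sum_3 supported_add)
qed

text \<open>Brings products into the order of \<open>dagger_F_psi\<close>. The first sign is that of
  a 1-form passing a 3-form, the second that of two 1-forms exchanged while the 2-form
  commutes.\<close>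

lemma wedge_\<Psi>_conj_\<Psi>_2:
  assumes "supported \<A> 2 \<omega>"
  shows "\<Psi> $ i \<^bold>\<and> (conj_form (\<Psi> $ j) \<^bold>\<and> \<omega>) = - (conj_form (\<Psi> $ j) \<^bold>\<and> (\<omega> \<^bold>\<and> \<Psi> $ i))"
    and "\<omega> \<^bold>\<and> (\<Psi> $ i \<^bold>\<and> conj_form (\<Psi> $ j)) = - (conj_form (\<Psi> $ j) \<^bold>\<and> (\<omega> \<^bold>\<and> \<Psi> $ i))"
proof -
  have sup: "supported \<A> 3 (conj_form (\<Psi> $ j) \<^bold>\<and> \<omega>)"
    using supported_wedge[OF sup_1(4) assms] by (simp add: numeral_eq_Suc)
  show "\<Psi> $ i \<^bold>\<and> (conj_form (\<Psi> $ j) \<^bold>\<and> \<omega>) = - (conj_form (\<Psi> $ j) \<^bold>\<and> (\<omega> \<^bold>\<and> \<Psi> $ i))"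
    using wedge_anticommute[OF sup_1(3) sup] by (simp add: wedge_assoc)
  have 1: "\<omega> \<^bold>\<and> (\<Psi> $ i \<^bold>\<and> conj_form (\<Psi> $ j)) = - ((\<omega> \<^bold>\<and> conj_form (\<Psi> $ j)) \<^bold>\<and> \<Psi> $ i)"
    using wedge_anticommute[OF sup_1(3,4), of i j] by (simp add: wedge_assoc wedge_minus_right)
  have 2: "\<omega> \<^bold>\<and> conj_form (\<Psi> $ j) = conj_form (\<Psi> $ j) \<^bold>\<and> \<omega>"
    by (rule wedge_commute[OF assms sup_1(4)]) simp
  show "\<omega> \<^bold>\<and> (\<Psi> $ i \<^bold>\<and> conj_form (\<Psi> $ j)) = - (conj_form (\<Psi> $ j) \<^bold>\<and> (\<omega> \<^bold>\<and> \<Psi> $ i))"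
    unfolding 1 2 by (simp only: wedge_assoc)
qed

lemma wedge_da_conj_\<Psi>: "conj_form (\<Psi> $ i) \<^bold>\<and> (ext_d \<A> a \<^bold>\<and> \<omega>) = ext_d \<A> a \<^bold>\<and> (conj_form (\<Psi> $ i) \<^bold>\<and> \<omega>)"
proof -
  have "conj_form (\<Psi> $ i) \<^bold>\<and> ext_d \<A> a = ext_d \<A> a \<^bold>\<and> conj_form (\<Psi> $ i)"
    by (rule wedge_commute[OF sup_1(4) supported_da]) simp
  then show ?thesis by (simp add: wedge_assoc[symmetric])
qed

text \<open>The previous rule for the 2-form \<Psi> \<and> \<Psi>\<dagger>; it is the source of the
  minus sign of the quartic term in \<open>trace_PP\<close>.\<close>

lemma wedge_\<Psi>_quartic:
  "\<Psi> $ i \<^bold>\<and> (conj_form (\<Psi> $ j) \<^bold>\<and> (\<Psi> $ k \<^bold>\<and> conj_form (\<Psi> $ l))) =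
    - (conj_form (\<Psi> $ j) \<^bold>\<and> (\<Psi> $ k \<^bold>\<and> (conj_form (\<Psi> $ l) \<^bold>\<and> \<Psi> $ i)))"
  using wedge_\<Psi>_conj_\<Psi>_2(1)[OF is_form_supported[OF is_form_wedge_1_1[OF atlas form_\<Psi> form_conj_\<Psi>]]]
  by (simp add: wedge_assoc)

section \<open>The four block contributions to the trace\<close>

text \<open>The traced square of F + da - \<Psi> \<and> \<Psi>\<dagger>. The coefficient of da
  \<and> da is the trace 2 of the identity; the mixed terms with \<Psi> carry -2 and become +2 when
  reordered.\<close>

lemma trace_PP:
  "curvature \<A> C $ 1 $ 1 \<^bold>\<and> curvature \<A> C $ 1 $ 1 + curvature \<A> C $ 1 $ 2 \<^bold>\<and> curvature \<A> C $ 2 $ 1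
    + (curvature \<A> C $ 2 $ 1 \<^bold>\<and> curvature \<A> C $ 1 $ 2 + curvature \<A> C $ 2 $ 2 \<^bold>\<and> curvature \<A> C $ 2 $ 2) =
   trace (F \<^bold>\<and>\<^sub>m F) + scale_form 2 (ext_d \<A> a \<^bold>\<and> ext_d \<A> a) + scale_form 2 (dagger_F_psi \<Psi> F)
     + scale_form 2 (ext_d \<A> a \<^bold>\<and> dagger_psi \<Psi>) - dagger_psi \<Psi> \<^bold>\<and> dagger_psi \<Psi>"
proof -
  have F_da: "F $ i $ j \<^bold>\<and> ext_d \<A> a = ext_d \<A> a \<^bold>\<and> F $ i $ j" for i j
    by (rule wedge_commute[OF supported_F supported_da]) simp
  show ?thesis
    unfolding cartan_curvature_22
    by (simp add: trace_def mwedge_def dagger_F_psi_def dagger_psi_def sum_2 wedge_linear trace_F F_da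
        wedge_assoc wedge_\<Psi>_conj_\<Psi>_2[OF supported_F] wedge_\<Psi>_conj_\<Psi>_2[OF supported_da]
        wedge_da_conj_\<Psi> wedge_\<Psi>_quartic)
      (simp add: fun_eq_iff scale_form_def)
qed

lemma trace_QQ:
  "curvature \<A> C $ 3 $ 3 \<^bold>\<and> curvature \<A> C $ 3 $ 3 =
    scale_form 4 (ext_d \<A> a \<^bold>\<and> ext_d \<A> a) + scale_form 4 (ext_d \<A> a \<^bold>\<and> dagger_psi \<Psi>)
    + dagger_psi \<Psi> \<^bold>\<and> dagger_psi \<Psi>"
proof -
  have "dagger_psi \<Psi> \<^bold>\<and> ext_d \<A> a = ext_d \<A> a \<^bold>\<and> dagger_psi \<Psi>"
  proof (rule wedge_commute[OF _ supported_da])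
    show "supported \<A> 2 (dagger_psi \<Psi>)"
      unfolding dagger_psi_def sum_2
      by (intro is_form_supported is_form_add is_form_wedge_1_1 atlas form_\<Psi> form_conj_\<Psi>)
  qed simp
  then show ?thesis
    by (simp add: cartan_curvature_33 wedge_linear) (simp add: fun_eq_iff scale_form_def)
qed

text \<open>This is D D \<Psi> = (F + 3 da) \<and> \<Psi>, solved for the plain derivative of
  \<open>D i\<close>.\<close>

lemma bianchi:
  "ext_d \<A> (D i) = F $ i $ 1 \<^bold>\<and> \<Psi> $ 1 + F $ i $ 2 \<^bold>\<and> \<Psi> $ 2 + scale_form 3 (ext_d \<A> a \<^bold>\<and> \<Psi> $ i)
    - (A $ i $ 1 \<^bold>\<and> D 1 + A $ i $ 2 \<^bold>\<and> D 2) - scale_form 3 (a \<^bold>\<and> D i)"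
proof -
  note forms = is_form_add[OF atlas] is_form_ext_d_1[OF atlas] is_form_wedge_1_1[OF atlas]
    is_form_scale[OF atlas] form_A form_a form_\<Psi>
  have "ext_d \<A> (D i) = ext_d \<A> (ext_d \<A> (\<Psi> $ i)) + (ext_d \<A> (A $ i $ 1 \<^bold>\<and> \<Psi> $ 1)
      + ext_d \<A> (A $ i $ 2 \<^bold>\<and> \<Psi> $ 2)) + scale_form 3 (ext_d \<A> (a \<^bold>\<and> \<Psi> $ i))"
    unfolding frame_derivative_def
    by (subst ext_d_add[OF atlas, of 2 _ 2] ext_d_scale[OF atlas, of 2], (intro forms)+)+ simp
  also have "\<dots> = (ext_d \<A> (A $ i $ 1) \<^bold>\<and> \<Psi> $ 1 - A $ i $ 1 \<^bold>\<and> ext_d \<A> (\<Psi> $ 1)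
      + (ext_d \<A> (A $ i $ 2) \<^bold>\<and> \<Psi> $ 2 - A $ i $ 2 \<^bold>\<and> ext_d \<A> (\<Psi> $ 2)))
      + scale_form 3 (ext_d \<A> a \<^bold>\<and> \<Psi> $ i - a \<^bold>\<and> ext_d \<A> (\<Psi> $ i))"
    by (simp add: ext_d_ext_d_1[OF atlas form_\<Psi>] ext_d_wedge_1_1[OF atlas form_A form_\<Psi>]
        ext_d_wedge_1_1[OF atlas form_a form_\<Psi>])
  finally show ?thesis
    by (simp add: frame_derivative_def curvature_nth sum_2 wedge_linear wedge_assoc wedge_A_a wedge_a_a)
      (simp add: fun_eq_iff scale_form_def algebra_simps)
qed

text \<open>In the derivative of \<open>frame_3_form\<close>, the A and a terms of
  \<open>bianchi\<close> complete the derivative of the conjugate frame to the lower left block of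
  the curvature, up to sign. The curvature terms of \<open>bianchi\<close> remain.\<close>

lemma trace_QP:
  "curvature \<A> C $ 3 $ 1 \<^bold>\<and> curvature \<A> C $ 1 $ 3 + curvature \<A> C $ 3 $ 2 \<^bold>\<and> curvature \<A> C $ 2 $ 3 =
    - (ext_d \<A> (frame_3_form \<A> A a \<Psi>) + dagger_F_psi \<Psi> F + scale_form 3 (ext_d \<A> a \<^bold>\<and> dagger_psi \<Psi>))"
proof -
  have d: "ext_d \<A> (frame_3_form \<A> A a \<Psi>) =
    (ext_d \<A> (conj_form (\<Psi> $ 1)) \<^bold>\<and> D 1 - conj_form (\<Psi> $ 1) \<^bold>\<and> ext_d \<A> (D 1))
    + (ext_d \<A> (conj_form (\<Psi> $ 2)) \<^bold>\<and> D 2 - conj_form (\<Psi> $ 2) \<^bold>\<and> ext_d \<A> (D 2))"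
    unfolding frame_3_form_def
    by (simp add: ext_d_add[OF atlas is_form_wedge_1_2 is_form_wedge_1_2, OF atlas form_conj_\<Psi> form_D
          atlas form_conj_\<Psi> form_D] ext_d_wedge_1_2[OF atlas form_conj_\<Psi> form_D])
  show ?thesis
    unfolding d bianchi cartan_curvature_i3 cartan_curvature_3i
    by (simp add: dagger_F_psi_def dagger_psi_def sum_2 wedge_linear wedge_assoc wedge_da_conj_\<Psi>)
      (simp add: fun_eq_iff scale_form_def)
qed

lemma trace_PQ:
  "curvature \<A> C $ 1 $ 3 \<^bold>\<and> curvature \<A> C $ 3 $ 1 + curvature \<A> C $ 2 $ 3 \<^bold>\<and> curvature \<A> C $ 3 $ 2 =
   curvature \<A> C $ 3 $ 1 \<^bold>\<and> curvature \<A> C $ 1 $ 3 + curvature \<A> C $ 3 $ 2 \<^bold>\<and> curvature \<A> C $ 2 $ 3"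
proof -
  have "curvature \<A> C $ i $ 3 \<^bold>\<and> curvature \<A> C $ 3 $ i = curvature \<A> C $ 3 $ i \<^bold>\<and> curvature \<A> C $ i $ 3" for i
    by (rule wedge_commute[OF supported_cartan_curvature supported_cartan_curvature]) simp
  then show ?thesis by simp
qed

lemma form_frame_3_form: "is_form \<A> 3 (frame_3_form \<A> A a \<Psi>)"
  unfolding frame_3_form_def
  by (intro is_form_add is_form_wedge_1_2 atlas form_conj_\<Psi> form_D)

text \<open>Expresses the 3-form through entries of the Cartan connection and its curvature, whose
  gauge behaviour is known. The minus sign undoes that of the lower left block.\<close>

lemma frame_3_form_eval:
  "frame_3_form \<A> A a \<Psi> [X, Y, Z] x =
    (let t = (\<lambda>U V W. - (\<Sum>i\<in>{1, 2}.
        eval_matrix C [U] x $ 3 $ i * eval_matrix (curvature \<A> C) [V, W] x $ i $ 3))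
     in t X Y Z - t Y X Z + t Z X Y)"
  unfolding frame_3_form_def
  using wedge_1_2[OF sup_1(4) is_form_supported[OF form_D]]
  by (simp add: eval_matrix_def cartan_curvature_i3) (simp add: cartan_connection_def)

text \<open>The trace weights the product of the curvature entries (i, j) and (j, i) by p or q
  according to i, and by r or s according to j; the four block traces then give all
  coefficients.\<close>

lemma MDM_integrand_eq:
  "MDM_integrand \<A> p q r s A a \<Psi> =
    frame_integrand \<A> (2 * (p * r) - (p * s + q * r)) (2 * (p * r) + 4 * (q * s) - 3 * (p * s + q * r))
      (q * s - p * r) A a \<Psi>
    + scale_form (complex_of_real (p * r)) (trace (F \<^bold>\<and>\<^sub>m F))
    + scale_form (complex_of_real (2 * (p * r) + 4 * (q * s))) (ext_d \<A> a \<^bold>\<and> ext_d \<A> a)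
    + ext_d \<A> (scale_form (complex_of_real (- (p * s + q * r))) (frame_3_form \<A> A a \<Psi>))"
proof -
  let ?f = "curvature \<A> C"
  have "MDM_integrand \<A> p q r s A a \<Psi> =
    scale_form (complex_of_real (p * r)) (?f $ 1 $ 1 \<^bold>\<and> ?f $ 1 $ 1 + ?f $ 1 $ 2 \<^bold>\<and> ?f $ 2 $ 1
      + (?f $ 2 $ 1 \<^bold>\<and> ?f $ 1 $ 2 + ?f $ 2 $ 2 \<^bold>\<and> ?f $ 2 $ 2))
    + scale_form (complex_of_real (p * s)) (?f $ 1 $ 3 \<^bold>\<and> ?f $ 3 $ 1 + ?f $ 2 $ 3 \<^bold>\<and> ?f $ 3 $ 2)
    + scale_form (complex_of_real (q * r)) (?f $ 3 $ 1 \<^bold>\<and> ?f $ 1 $ 3 + ?f $ 3 $ 2 \<^bold>\<and> ?f $ 2 $ 3)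
    + scale_form (complex_of_real (q * s)) (?f $ 3 $ 3 \<^bold>\<and> ?f $ 3 $ 3)"
    by (simp add: MDM_integrand_def Let_def trace_def mwedge_def mscale_def sum_3 P_proj_def Q_proj_def
        wedge_linear) (simp add: fun_eq_iff scale_form_def scaleR_conv_of_real algebra_simps)
  then show ?thesis
    unfolding trace_PQ trace_PP trace_QQ trace_QP frame_integrand_def
      ext_d_scale[OF atlas form_frame_3_form]
    by (simp add: fun_eq_iff scale_form_def algebra_simps)
qed

end


section \<open>Invariance of the boundary term\<close>

lemma frame_3_form_invariant:
  fixes \<A> :: "('m::{t2_space, second_countable_topology}, 'e::euclidean_space) atlas"
  assumes "smooth_atlas \<A>"
  shows "U2_invariant \<A> (frame_3_form \<A>)"
  unfolding U2_invariant_def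
proof (intro allI impI)
  fix h A a \<Psi> A' a' \<Psi>'
  assume gauge: "is_gauge_map \<A> h" and config: "field_config \<A> A a \<Psi>" "field_config \<A> A' a' \<Psi>'"
    and eq: "cartan_connection A' a' \<Psi>' = gauge_transform \<A> h (cartan_connection A a \<Psi>)"
  interpret f: field_configuration \<A> A a \<Psi> using assms config by unfold_locales
  interpret f': field_configuration \<A> A' a' \<Psi>' using assms config by unfold_locales
  have smooth_h: "smooth_matrix \<A> h"
    using gauge by (simp add: is_gauge_map_def smooth_matrix_def smooth_fun_nth[OF assms])
  define k where "k = (\<lambda>x. adjoint_matrix (h x))"
  have unitary: "h x ** k x = mat 1" for x
    using gauge by (simp add: k_def is_gauge_map_def U2_subgroup_def adjoint_matrix_def)
  have h0: "h x $ 1 $ 3 = 0" "h x $ 2 $ 3 = 0" "h x $ 3 $ 1 = 0" "h x $ 3 $ 2 = 0" for x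
    using gauge by (simp_all add: is_gauge_map_def U2_subgroup_def)
  then have k0: "k x $ 1 $ 3 = 0" "k x $ 2 $ 3 = 0" "k x $ 3 $ 1 = 0" "k x $ 3 $ 2 = 0" for x
    by (simp_all add: k_def adjoint_matrix_def)
  \<comment> \<open>Unitarity is given as h k = 1, whereas the contraction below places k to the
    left of h.\<close>
  have kh: "k x ** h x = mat 1" for x
    using unitary matrix_left_right_inverse by blast
  have k_h: "k x $ 1 $ 1 * h x $ 1 $ 1 + k x $ 1 $ 2 * h x $ 2 $ 1 = 1"
    "k x $ 1 $ 1 * h x $ 1 $ 2 + k x $ 1 $ 2 * h x $ 2 $ 2 = 0"
    "k x $ 2 $ 1 * h x $ 1 $ 1 + k x $ 2 $ 2 * h x $ 2 $ 1 = 0"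
    "k x $ 2 $ 1 * h x $ 1 $ 2 + k x $ 2 $ 2 * h x $ 2 $ 2 = 1"
    "k x $ 3 $ 3 * h x $ 3 $ 3 = 1" for x
    using arg_cong[OF kh[of x], of "\<lambda>M. M $ 1 $ 1"] arg_cong[OF kh[of x], of "\<lambda>M. M $ 1 $ 2"]
      arg_cong[OF kh[of x], of "\<lambda>M. M $ 2 $ 1"] arg_cong[OF kh[of x], of "\<lambda>M. M $ 2 $ 2"]
      arg_cong[OF kh[of x], of "\<lambda>M. M $ 3 $ 3"]
    by (simp_all add: matrix_matrix_mult_def sum_3 mat_def h0 k0)
  have contract: "(\<Sum>i\<in>{1, 2}. eval_matrix f'.C [U] x $ 3 $ i * eval_matrix (curvature \<A> f'.C) [V, W] x $ i $ 3)
      = (\<Sum>i\<in>{1, 2}. eval_matrix f.C [U] x $ 3 $ i * eval_matrix (curvature \<A> f.C) [V, W] x $ i $ 3)"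
    if vf: "U \<in> vector_fields \<A>" "V \<in> vector_fields \<A>" "W \<in> vector_fields \<A>" for U V W x
  proof -
    define b where "b = eval_matrix f.C [U] x"
    define g where "g = eval_matrix (curvature \<A> f.C) [V, W] x"
    have C': "eval_matrix f'.C [U] x = h x ** b ** k x + h x ** derive_matrix U k x"
      unfolding eq b_def k_def by (rule eval_gauge_transform[OF vf(1)])
    have g': "eval_matrix (curvature \<A> f'.C) [V, W] x = h x ** g ** k x"
      unfolding g_def k_def
      by (rule curvature_gauge_covariant[OF assms smooth_h unitary[unfolded k_def]
            f.form_cartan f'.form_cartan eq vf(2,3)])
    \<comment> \<open>These entries of k vanish identically, hence so do their derivatives; the
      inhomogeneous term never reaches the lower left block.\<close>
    have dk: "derive_matrix U k x $ 3 $ 1 = 0" "derive_matrix U k x $ 3 $ 2 = 0"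
      by (simp_all add: derive_matrix_def k0 derive_complex_const[OF vf(1)])
    have b': "eval_matrix f'.C [U] x $ 3 $ 1 = h x $ 3 $ 3 * (b $ 3 $ 1 * k x $ 1 $ 1 + b $ 3 $ 2 * k x $ 2 $ 1)"
      "eval_matrix f'.C [U] x $ 3 $ 2 = h x $ 3 $ 3 * (b $ 3 $ 1 * k x $ 1 $ 2 + b $ 3 $ 2 * k x $ 2 $ 2)"
      unfolding C' by (simp_all add: matrix_matrix_mult_def sum_3 h0 k0 dk algebra_simps)
    have g'_nth: "eval_matrix (curvature \<A> f'.C) [V, W] x $ 1 $ 3 =
        (h x $ 1 $ 1 * g $ 1 $ 3 + h x $ 1 $ 2 * g $ 2 $ 3) * k x $ 3 $ 3"
      "eval_matrix (curvature \<A> f'.C) [V, W] x $ 2 $ 3 =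
        (h x $ 2 $ 1 * g $ 1 $ 3 + h x $ 2 $ 2 * g $ 2 $ 3) * k x $ 3 $ 3"
      unfolding g' by (simp_all add: matrix_matrix_mult_def sum_3 h0 k0)
    \<comment> \<open>Regrouped into the entries of the 2 x 2 block of k h, times the product of the
      two (3, 3) phases; \<open>k_h\<close> evaluates all of them.\<close>
    have "(\<Sum>i\<in>{1, 2}. eval_matrix f'.C [U] x $ 3 $ i * eval_matrix (curvature \<A> f'.C) [V, W] x $ i $ 3) =
      (k x $ 3 $ 3 * h x $ 3 $ 3) *
        (b $ 3 $ 1 * g $ 1 $ 3 * (k x $ 1 $ 1 * h x $ 1 $ 1 + k x $ 1 $ 2 * h x $ 2 $ 1)
        + b $ 3 $ 1 * g $ 2 $ 3 * (k x $ 1 $ 1 * h x $ 1 $ 2 + k x $ 1 $ 2 * h x $ 2 $ 2)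
        + b $ 3 $ 2 * g $ 1 $ 3 * (k x $ 2 $ 1 * h x $ 1 $ 1 + k x $ 2 $ 2 * h x $ 2 $ 1)
        + b $ 3 $ 2 * g $ 2 $ 3 * (k x $ 2 $ 1 * h x $ 1 $ 2 + k x $ 2 $ 2 * h x $ 2 $ 2))"
      by (simp add: b' g'_nth algebra_simps)
    then show ?thesis unfolding k_h by (simp add: b_def g_def)
  qed
  show "frame_3_form \<A> A' a' \<Psi>' = frame_3_form \<A> A a \<Psi>"
  proof (rule supported_eqI[OF f'.form_frame_3_form[THEN is_form_supported]
        f.form_frame_3_form[THEN is_form_supported]])
    fix Xs x assume "length Xs = 3" "set Xs \<subseteq> vector_fields \<A>"
    then obtain X Y Z where Xs: "Xs = [X, Y, Z]" and
      vf: "X \<in> vector_fields \<A>" "Y \<in> vector_fields \<A>" "Z \<in> vector_fields \<A>"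
      by (auto simp: numeral_3_eq_3 length_Suc_conv)
    show "frame_3_form \<A> A' a' \<Psi>' Xs x = frame_3_form \<A> A a \<Psi> Xs x"
      unfolding Xs f'.frame_3_form_eval f.frame_3_form_eval Let_def
        contract[OF vf] contract[OF vf(2,1,3)] contract[OF vf(3,1,2)] ..
  qed
qed

lemma frame_3_form_built: "frame_3_form \<A> \<in> built_from_fields \<A>"
proof -
  note d = built_from_fields.ext_d[OF built_from_fields.frame]
    and w = built_from_fields.wedge[OF built_from_fields.su2 built_from_fields.frame]
    and c = built_from_fields.wedge[OF built_from_fields.conj[OF built_from_fields.frame]]
  have D: "(\<lambda>A a \<Psi>. frame_derivative \<A> A a \<Psi> i) \<in> built_from_fields \<A>" for i
    unfolding frame_derivative_def
    by (rule built_from_fields.add[OF built_from_fields.add[OF d built_from_fields.add[OF w w]]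
        built_from_fields.scale[OF built_from_fields.wedge[OF built_from_fields.u1 built_from_fields.frame]]])
  have "(\<lambda>A a \<Psi>. frame_3_form \<A> A a \<Psi>) \<in> built_from_fields \<A>"
    unfolding frame_3_form_def
    by (rule built_from_fields.add[OF c[OF D] c[OF D]])
  then show ?thesis by simp
qed

lemma frame_3_form_invariant_3_form:
  fixes \<A> :: "('m::{t2_space, second_countable_topology}, 'e::euclidean_space) atlas"
  assumes "smooth_atlas \<A>"
  shows "(\<lambda>A a \<Psi>. scale_form c (frame_3_form \<A> A a \<Psi>)) \<in> invariant_3_forms \<A>"
  unfolding invariant_3_forms_def
proof (intro CollectI conjI allI impI)
  have "(\<lambda>A a \<Psi>. frame_3_form \<A> A a \<Psi>) \<in> built_from_fields \<A>"
    using frame_3_form_built[of \<A>] by simp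
  then show "(\<lambda>A a \<Psi>. scale_form c (frame_3_form \<A> A a \<Psi>)) \<in> built_from_fields \<A>"
    by (rule built_from_fields.scale)
  show "U2_invariant \<A> (\<lambda>A a \<Psi>. scale_form c (frame_3_form \<A> A a \<Psi>))"
    using frame_3_form_invariant[OF assms] unfolding U2_invariant_def by metis
  fix A a \<Psi> assume "field_config \<A> A a \<Psi>"
  then interpret field_configuration \<A> A a \<Psi> using assms by unfold_locales
  show "is_form \<A> 3 (scale_form c (frame_3_form \<A> A a \<Psi>))"
    by (rule is_form_scale[OF assms form_frame_3_form])
qed

section \<open>The functionals modulo topological terms\<close>

lemma MDM_equal_mod_topological:
  fixes \<A> :: "('m::{t2_space, second_countable_topology}, 'e::euclidean_space) atlas"
  assumes "smooth_atlas \<A>"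
  shows "equal_mod_topological \<A> (MDM_integrand \<A> p q r s)
    (frame_integrand \<A> (2 * (p * r) - (p * s + q * r))
      (2 * (p * r) + 4 * (q * s) - 3 * (p * s + q * r)) (q * s - p * r))"
  unfolding equal_mod_topological_def
proof (intro exI bexI allI impI)
  fix A a \<Psi> assume "field_config \<A> A a \<Psi>"
  then interpret field_configuration \<A> A a \<Psi> using assms by unfold_locales
  \<comment> \<open>The two constants and the 3-form were left schematic; this equation fixes them,
    and membership of the 3-form remains for the end.\<close>
  show "MDM_integrand \<A> p q r s A a \<Psi> =
    frame_integrand \<A> (2 * (p * r) - (p * s + q * r)) (2 * (p * r) + 4 * (q * s) - 3 * (p * s + q * r))
      (q * s - p * r) A a \<Psi>
    + scale_form (complex_of_real (p * r)) (trace (curvature \<A> A \<^bold>\<and>\<^sub>m curvature \<A> A))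
    + scale_form (complex_of_real (2 * (p * r) + 4 * (q * s))) (ext_d \<A> a \<^bold>\<and> ext_d \<A> a)
    + ext_d \<A> (scale_form (complex_of_real (- (p * s + q * r))) (frame_3_form \<A> A a \<Psi>))"
    by (rule MDM_integrand_eq)
qed (rule frame_3_form_invariant_3_form[OF assms])

theorem proposition1:
  fixes \<A> :: "('m::{t2_space, second_countable_topology}, real^4) atlas"
  assumes "smooth_atlas \<A>"
  shows "(\<forall>p q r s :: real. \<exists>lam mu nu :: real.
            3 * lam - mu + 4 * nu = 0 \<and>
            equal_mod_topological \<A> (MDM_integrand \<A> p q r s) (frame_integrand \<A> lam mu nu)) \<and>
         (\<forall>lam mu nu :: real. 3 * lam - mu + 4 * nu = 0 \<longrightarrow>
            (\<exists>p q r s :: real.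
            equal_mod_topological \<A> (MDM_integrand \<A> p q r s) (frame_integrand \<A> lam mu nu)))"
proof (intro conjI allI impI)
  fix p q r s :: real
  have "3 * (2 * (p * r) - (p * s + q * r)) - (2 * (p * r) + 4 * (q * s) - 3 * (p * s + q * r))
      + 4 * (q * s - p * r) = 0"
    by (simp add: algebra_simps)
  then show "\<exists>lam mu nu. 3 * lam - mu + 4 * nu = 0 \<and>
      equal_mod_topological \<A> (MDM_integrand \<A> p q r s) (frame_integrand \<A> lam mu nu)"
    using MDM_equal_mod_topological[OF assms] by blast
next
  fix lam mu nu :: real assume "3 * lam - mu + 4 * nu = 0"
  then have "mu = 3 * lam + 4 * nu" by simp
  \<comment> \<open>For p = 0 and q = 1 the parameters are (-r, 4s - 3r, s), so r and s are read off
    from the first and third, and the relation supplies the second.\<close>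
  then have "equal_mod_topological \<A> (MDM_integrand \<A> 0 1 (- lam) nu) (frame_integrand \<A> lam mu nu)"
    using MDM_equal_mod_topological[OF assms, of 0 1 "- lam" nu] by (simp add: algebra_simps)
  then show "\<exists>p q r s. equal_mod_topological \<A> (MDM_integrand \<A> p q r s) (frame_integrand \<A> lam mu nu)"
    by blast
qed

end
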